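(* The convex hull of $\bar X^{l,u}$ is exactly the set of all $(\delta,z)\in\mathbb{R}^4\times\mathbb{R}^J$, $\delta=(\delta_0,\delta_1,\delta_2,\delta_3)$, satisfying all of the following linear inequalities. (A) $\delta_0\le 1$; $-\delta_3\le 0$; $\delta_3\le\delta_i$ for $i\in\{1,2\}$; $\delta_1+\delta_2\le\delta_0+\delta_3$. (B) $\sum_{j\in J}z_j\le u$; $z_j+\delta_i\le 1$ for $j\in S_i$, $i\in\{0,1,2\}$; $z_j\le 1$ for $j\in J$; $1-\delta_0-\sum_{j\in S_0}z_j\le 0$; $\delta_0-\delta_i-\sum_{j\in S_i\setminus S_0}z_j\le 0$ for $i\in\{1,2\}$; $-z_j\le 0$ for $j\in J$; $-\sum_{j\in J}z_j\le -l$. (C) For every $Q\subseteq J$: 1. $\sum_{j\in Q}z_j+(u-|Q\setminus S_0|)\delta_0+\sum_{i=1}^2|(Q\cap S_i)\setminus S_0|\,\delta_i\le u$, if $|Q\setminus S_0|\le u$; 2. $\sum_{j\in Q}z_j+\sum_{i=1}^2(u-|Q\setminus S_i|)\delta_i+(|Q\setminus S_0|-u)\delta_3\le u$; 3. $\sum_{j\in Q}z_j+\delta_0-\delta_i+(u-1-|Q\setminus S_k|)\delta_k+\delta_3\le u$, for every $(i,k)$ with $\{i,k\}=\{1,2\}$ and $Q\cap(S_i\setminus S_0)=\emptyset$; 4. $\sum_{j\in Q}z_j+(u-|Q\setminus S_i|)\delta_i+|(Q\cap S_3)\setminus S_i|\,\delta_3\le u$, for every $i\in\{1,2\}$ with $|Q\setminus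 S_i|\le u$; 5. $\sum_{j\in Q}z_j+(u-|Q\setminus S_3|)\delta_3\le u$, if $|Q\setminus S_3|\le u$. (D) For every $Q\subseteq J$: 1. $-\sum_{j\in Q}z_j+(l+|Q\cup S_0|-n)\delta_0+\sum_{i=1}^2|S_i\setminus (S_0\cup Q)|\,\delta_i\le 0$, if $|Q\cup S_0|\ge n-l$; 2. $-\sum_{j\in Q}z_j+\sum_{i=1}^2(l+|Q\cup S_i|-n)\delta_i+(n-|Q\cup S_0|-l)\delta_3\le 0$; 3. $-\sum_{j\in Q}z_j+\delta_0-\delta_i+(l+|Q\cup S_k|-1-n)\delta_k+\delta_3\le 0$, for every $(i,k)$ with $\{i,k\}=\{1,2\}$ and $S_i\setminus S_0\subseteq Q$; 4. $-\sum_{j\in Q}z_j+(l+|Q\cup S_i|-n)\delta_i+|S_3\setminus (S_i\cup Q)|\,\delta_3\le 0$, for every $i\in\{1,2\}$ with $|Q\cup S_i|\ge n-l$; 5. $-\sum_{j\in Q}z_j+(l+|Q\cup S_3|-n)\delta_3\le 0$, if $|Q\cup S_3|\ge n-l$.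
   Context: Setting: $J$ is a finite set with $|J|=n$; $l,u$ are integers with $l\ge 0$, $u\ge 2$, $u\ge l+1$; $S_1,S_2\subseteq J$ satisfy $2\le|S_i|\le n-l$ for $i\in\{1,2\}$, $S_1\setminus S_2\ne\emptyset$ and $S_2\setminus S_1\neq\emptyset$. Put $S_0:=S_1\cap S_2$ and $S_3:=S_1\cup S_2$ ($S_0=\emptyset$ and $|S_3|>n-l$ are allowed). Define $$\bar X^{l,u}=\Big\{(\delta,z)\in\{0,1\}^4\times\{0,1\}^J:\ \delta_i=\prod_{j\in S_i}(1-z_j)\ (i=0,1,2,3),\ \ l\le\sum_{j\in J}z_j\le u\Big\},$$ where $\delta=(\delta_0,\delta_1,\delta_2,\delta_3)$ and an empty product equals $1$ (so $\delta_0=1$ if $S_0=\emptyset$). *)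

theory Defs
  imports "HOL-Analysis.Analysis"
begin

(* The ground set J is the universe of the finite type 'j, so n = CARD('j), R^J is real^'j, and
   the coordinates delta_0, ..., delta_3 are indexed by the four elements 0, 1, 2, 3 of the
   numeral type 4. *)

definition term_set :: "'j set \<Rightarrow> 'j set \<Rightarrow> 4 \<Rightarrow> 'j set" where
  "term_set S1 S2 i =
    (if i = 0 then S1 \<inter> S2 else if i = 1 then S1 else if i = 2 then S2 else S1 \<union> S2)"

definition Xbar :: "int \<Rightarrow> int \<Rightarrow> 'j::finite set \<Rightarrow> 'j set \<Rightarrow> ((real^4) \<times> (real^'j)) set" where
  "Xbar l u S1 S2 = {(\<delta>, z).
     (\<forall>i. \<delta> $ i \<in> {0, 1}) \<and> (\<forall>j. z $ j \<in> {0, 1}) \<and>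
     (\<forall>i. \<delta> $ i = (\<Prod>j\<in>term_set S1 S2 i. 1 - z $ j)) \<and>
     of_int l \<le> (\<Sum>j\<in>UNIV. z $ j) \<and> (\<Sum>j\<in>UNIV. z $ j) \<le> of_int u}"

definition delta_ineqs :: "real^4 \<Rightarrow> bool" where
  "delta_ineqs \<delta> \<longleftrightarrow>
     \<delta> $ 0 \<le> 1 \<and>
     - \<delta> $ 3 \<le> 0 \<and>
     (\<forall>i\<in>{1, 2}. \<delta> $ 3 \<le> \<delta> $ i) \<and>
     \<delta> $ 1 + \<delta> $ 2 \<le> \<delta> $ 0 + \<delta> $ 3"

definition basic_ineqs ::
  "int \<Rightarrow> int \<Rightarrow> 'j::finite set \<Rightarrow> 'j set \<Rightarrow> real^4 \<Rightarrow> real^'j \<Rightarrow> bool" where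
  "basic_ineqs l u S1 S2 \<delta> z \<longleftrightarrow>
    (let S = term_set S1 S2 in
     (\<Sum>j\<in>UNIV. z $ j) \<le> of_int u \<and>
     (\<forall>i\<in>{0, 1, 2}. \<forall>j\<in>S i. z $ j + \<delta> $ i \<le> 1) \<and>
     (\<forall>j. z $ j \<le> 1) \<and>
     1 - \<delta> $ 0 - (\<Sum>j\<in>S 0. z $ j) \<le> 0 \<and>
     (\<forall>i\<in>{1, 2}. \<delta> $ 0 - \<delta> $ i - (\<Sum>j\<in>S i - S 0. z $ j) \<le> 0) \<and>
     (\<forall>j. - z $ j \<le> 0) \<and>
     - (\<Sum>j\<in>UNIV. z $ j) \<le> - of_int l)"

definition upper_ineqs ::
  "int \<Rightarrow> 'j::finite set \<Rightarrow> 'j set \<Rightarrow> real^4 \<Rightarrow> real^'j \<Rightarrow> 'j set \<Rightarrow> bool" where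
  "upper_ineqs u S1 S2 \<delta> z Q \<longleftrightarrow>
    (let S = term_set S1 S2; c = (\<lambda>A. int (card A)) in
     (c (Q - S 0) \<le> u \<longrightarrow>
        (\<Sum>j\<in>Q. z $ j) + of_int (u - c (Q - S 0)) * \<delta> $ 0
          + (\<Sum>i\<in>{1, 2}. of_int (c ((Q \<inter> S i) - S 0)) * \<delta> $ i) \<le> of_int u) \<and>
     (\<Sum>j\<in>Q. z $ j) + (\<Sum>i\<in>{1, 2}. of_int (u - c (Q - S i)) * \<delta> $ i)
        + of_int (c (Q - S 0) - u) * \<delta> $ 3 \<le> of_int u \<and>
     (\<forall>i k. {i, k} = {1, 2} \<and> Q \<inter> (S i - S 0) = {} \<longrightarrow>
        (\<Sum>j\<in>Q. z $ j) + \<delta> $ 0 - \<delta> $ i + of_int (u - 1 - c (Q - S k)) * \<delta> $ k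
          + \<delta> $ 3 \<le> of_int u) \<and>
     (\<forall>i\<in>{1, 2}. c (Q - S i) \<le> u \<longrightarrow>
        (\<Sum>j\<in>Q. z $ j) + of_int (u - c (Q - S i)) * \<delta> $ i
          + of_int (c ((Q \<inter> S 3) - S i)) * \<delta> $ 3 \<le> of_int u) \<and>
     (c (Q - S 3) \<le> u \<longrightarrow>
        (\<Sum>j\<in>Q. z $ j) + of_int (u - c (Q - S 3)) * \<delta> $ 3 \<le> of_int u))"

definition lower_ineqs ::
  "int \<Rightarrow> 'j::finite set \<Rightarrow> 'j set \<Rightarrow> real^4 \<Rightarrow> real^'j \<Rightarrow> 'j set \<Rightarrow> bool" where
  "lower_ineqs l S1 S2 \<delta> z Q \<longleftrightarrow>
    (let S = term_set S1 S2; c = (\<lambda>A. int (card A)); n = int CARD('j) in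
     (c (Q \<union> S 0) \<ge> n - l \<longrightarrow>
        - (\<Sum>j\<in>Q. z $ j) + of_int (l + c (Q \<union> S 0) - n) * \<delta> $ 0
          + (\<Sum>i\<in>{1, 2}. of_int (c (S i - (S 0 \<union> Q))) * \<delta> $ i) \<le> 0) \<and>
     - (\<Sum>j\<in>Q. z $ j) + (\<Sum>i\<in>{1, 2}. of_int (l + c (Q \<union> S i) - n) * \<delta> $ i)
        + of_int (n - c (Q \<union> S 0) - l) * \<delta> $ 3 \<le> 0 \<and>
     (\<forall>i k. {i, k} = {1, 2} \<and> S i - S 0 \<subseteq> Q \<longrightarrow>
        - (\<Sum>j\<in>Q. z $ j) + \<delta> $ 0 - \<delta> $ i + of_int (l + c (Q \<union> S k) - 1 - n) * \<delta> $ k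
          + \<delta> $ 3 \<le> 0) \<and>
     (\<forall>i\<in>{1, 2}. c (Q \<union> S i) \<ge> n - l \<longrightarrow>
        - (\<Sum>j\<in>Q. z $ j) + of_int (l + c (Q \<union> S i) - n) * \<delta> $ i
          + of_int (c (S 3 - (S i \<union> Q))) * \<delta> $ 3 \<le> 0) \<and>
     (c (Q \<union> S 3) \<ge> n - l \<longrightarrow>
        - (\<Sum>j\<in>Q. z $ j) + of_int (l + c (Q \<union> S 3) - n) * \<delta> $ 3 \<le> 0))"

end

theory Submission
  imports Defs
begin

text \<open>
  On a vertex only five patterns of \<open>\<delta>\<close> occur, and \<open>\<delta>\<close> determines the weights
  \<open>1 - \<delta>\<^sub>0\<close>, \<open>\<delta>\<^sub>0 + \<delta>\<^sub>3 - \<delta>\<^sub>1 - \<delta>\<^sub>2\<close>, \<open>\<delta>\<^sub>1 - \<delta>\<^sub>3\<close>, \<open>\<delta>\<^sub>2 - \<delta>\<^sub>3\<close>, \<open>\<delta>\<^sub>3\<close> of the patterns in a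
  convex combination. For a fixed pattern the admissible \<open>z\<close> are the indicators of the subsets \<open>X\<close>
  of some \<open>A\<close> that satisfy \<open>l \<le> |X| \<le> u\<close> and meet at most two disjoint blocks. They span a
  generalised polymatroid: a set \<open>X\<close> maximising a linear weight simultaneously attains the
  largest \<open>|X \<inter> Q|\<close> on every positive upper level set \<open>Q\<close> and the smallest one on every negative
  lower level set. By separation and Abel summation, \<open>(\<delta>, z)\<close> lies in the convex hull if for every
  \<open>Q\<close> the value \<open>z(Q)\<close> lies between the weighted sums of the least and of the greatest possible
  \<open>|X \<inter> Q|\<close>. Distinguishing the patterns for which \<open>|A \<inter> Q|\<close> exceeds the capacity, one derives these
  bounds from (B), (C) and (D).
\<close>

section \<open>Hitting sets and their rank functions\<close>

definition hitting_sets :: "int \<Rightarrow> int \<Rightarrow> 'j set \<Rightarrow> 'j set set \<Rightarrow> 'j set set" where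
  "hitting_sets l u A \<B> =
     {X. X \<subseteq> A \<and> l \<le> int (card X) \<and> int (card X) \<le> u \<and> (\<forall>B\<in>\<B>. X \<inter> B \<noteq> {})}"

text \<open>For disjoint blocks inside \<open>A\<close>, and if a hitting set exists, this is the
  greatest \<open>card (X \<inter> Q)\<close> over the hitting sets \<open>X\<close>: of at most
  \<open>u\<close> elements, every block that misses \<open>Q\<close> claims one outside
  \<open>Q\<close>.\<close>

definition upper_rank :: "int \<Rightarrow> 'j set \<Rightarrow> 'j set set \<Rightarrow> 'j set \<Rightarrow> int" where
  "upper_rank u A \<B> Q = min (int (card (Q \<inter> A))) (u - int (card {B \<in> \<B>. B \<inter> Q = {}}))"

text \<open>Dually the least \<open>card (X \<inter> Q)\<close>: every block inside \<open>Q\<close>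
  needs an element of its own there, and at most \<open>card (A - Q)\<close> elements of
  \<open>X\<close> lie outside \<open>Q\<close>.\<close>

definition lower_rank :: "int \<Rightarrow> 'j set \<Rightarrow> 'j set set \<Rightarrow> 'j set \<Rightarrow> int" where
  "lower_rank l A \<B> Q = max (int (card {B \<in> \<B>. B \<subseteq> Q})) (l - int (card (A - Q)))"

lemma card_union2:
  fixes B :: "'j::finite set"
  assumes "A = B \<union> C" "B \<inter> C = {}"
  shows "card A = card B + card C"
  using assms by (simp add: card_Un_disjoint)

text \<open>One representative per block gives a set of at most \<open>u\<close> elements, which is
  padded inside \<open>A\<close> up to size \<open>l\<close> if it is smaller.\<close>

lemma hitting_sets_nonempty:
  fixes A :: "'j::finite set"
  assumes "int (card \<B>) \<le> u" "l \<le> u" "l \<le> int (card A)"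
    and "\<And>B. B \<in> \<B> \<Longrightarrow> B \<subseteq> A \<and> B \<noteq> {}"
  shows "hitting_sets l u A \<B> \<noteq> {}"
proof -
  have "\<forall>B\<in>\<B>. \<exists>x. x \<in> B" using assms(4) by blast
  from bchoice[OF this] obtain f where f: "\<And>B. B \<in> \<B> \<Longrightarrow> f B \<in> B" by blast
  define T where "T = f ` \<B>"
  have "T \<subseteq> A" using f assms(4) unfolding T_def by blast
  have "int (card T) \<le> u"
    using card_image_le[of \<B> f] assms(1) unfolding T_def by simp
  have "card T \<le> card A" using \<open>T \<subseteq> A\<close> by (simp add: card_mono)
  then have "max (card T) (nat l) \<le> card A" using assms(3) by linarith
  obtain X where X: "T \<subseteq> X" "X \<subseteq> A" "card X = max (card T) (nat l)"
    using exists_subset_between[OF max.cobounded1 \<open>max (card T) (nat l) \<le> card A\<close> \<open>T \<subseteq> A\<close>]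
    by auto
  have "X \<inter> B \<noteq> {}" if "B \<in> \<B>" for B
  proof -
    have "f B \<in> X \<inter> B" using f[OF that] X(1) that unfolding T_def by auto
    then show ?thesis by blast
  qed
  then have "X \<in> hitting_sets l u A \<B>"
    using X \<open>int (card T) \<le> u\<close> assms(2) unfolding hitting_sets_def by auto
  then show ?thesis by blast
qed

section \<open>Exchange arguments at a hitting set of maximal weight\<close>

context
  fixes l u :: int and A :: "'j::finite set" and \<B> :: "'j set set" and a :: "'j \<Rightarrow> real" and X
  assumes disj: "disjoint \<B>" and sub: "\<And>B. B \<in> \<B> \<Longrightarrow> B \<subseteq> A"
    and X: "X \<in> hitting_sets l u A \<B>"
    and max: "\<And>Y. Y \<in> hitting_sets l u A \<B> \<Longrightarrow> sum a Y \<le> sum a X"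
begin

text \<open>Replacing \<open>x\<close> by the heavier \<open>y\<close> keeps the cardinality and
  raises the weight, so by maximality it must leave some block unhit.\<close>

lemma swap_blocked:
  assumes "x \<in> X" "y \<in> A - X" "a x < a y"
  obtains B where "B \<in> \<B>" "X \<inter> B = {x}" "y \<notin> B"
proof (rule ccontr)
  assume "\<not> thesis"
  with that have free: "\<And>B. B \<in> \<B> \<Longrightarrow> X \<inter> B = {x} \<Longrightarrow> y \<in> B" by blast
  let ?Y = "insert y (X - {x})"
  have "card X > 0" using assms by (auto simp: card_gt_0_iff)
  then have "card ?Y = card X" using assms by (simp add: card_Diff_singleton)
  moreover have "?Y \<inter> B \<noteq> {}" if "B \<in> \<B>" for B
    using free[OF that] X that unfolding hitting_sets_def by blast
  ultimately have "?Y \<in> hitting_sets l u A \<B>"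
    using X assms unfolding hitting_sets_def by auto
  moreover have "sum a ?Y = sum a X + a y - a x"
    using assms by (simp add: sum_diff1)
  ultimately show False using max assms(3) by force
qed

text \<open>Exchanging the only element of \<open>X\<close> in a block inside this block keeps every block hit.\<close>

lemma sole_hit_optimal:
  assumes "B \<in> \<B>" "X \<inter> B = {x}" "y \<in> B"
  shows "a y \<le> a x"
proof (rule ccontr)
  assume "\<not> a y \<le> a x"
  then have "y \<noteq> x" by auto
  then have "y \<in> A - X" using assms sub by blast
  with \<open>\<not> a y \<le> a x\<close> obtain B' where B': "B' \<in> \<B>" "X \<inter> B' = {x}" "y \<notin> B'"
    using swap_blocked[of x y] assms by auto
  have "B' = B" using disj B' assms unfolding disjoint_def by blast
  with B' assms show False by blast
qed

text \<open>Different \<open>x\<close> have different witnessing blocks, since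
  \<open>X \<inter> B\<close> recovers \<open>x\<close>.\<close>

lemma card_sole_hits_le:
  assumes "\<And>x. x \<in> V \<Longrightarrow> \<exists>B\<in>\<C>. X \<inter> B = {x}"
  shows "card V \<le> card \<C>"
proof -
  obtain f where f: "\<And>x. x \<in> V \<Longrightarrow> f x \<in> \<C> \<and> X \<inter> f x = {x}"
    using assms by metis
  have "inj_on f V" using f by (intro inj_onI) (metis singleton_inject)
  moreover have "f ` V \<subseteq> \<C>" using f by blast
  ultimately show ?thesis by (metis card_inj_on_le finite)
qed

text \<open>Otherwise some \<open>y\<close> of the level set is left out of a full \<open>X\<close>.
  Each lighter \<open>x\<close> in \<open>X\<close> then cannot be swapped for \<open>y\<close>, so
  it is the sole hit of a block; \<open>sole_hit_optimal\<close> puts this whole block below the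
  level \<open>s\<close>. Hence \<open>X\<close> spends no more elements outside the level set than
  there are blocks missing it.\<close>

lemma maximal_upper_rank:
  assumes "s > 0"
  shows "upper_rank u A \<B> {j. s \<le> a j} \<le> int (card (X \<inter> {j. s \<le> a j}))"
proof (rule ccontr)
  let ?Q = "{j. s \<le> a j}"
  assume "\<not> ?thesis"
  then have lt: "card (X \<inter> ?Q) < card (?Q \<inter> A)"
      "int (card (X \<inter> ?Q)) < u - int (card {B \<in> \<B>. B \<inter> ?Q = {}})"
    unfolding upper_rank_def by auto
  have "\<not> ?Q \<inter> A \<subseteq> X \<inter> ?Q" using card_mono[OF finite, of "?Q \<inter> A" "X \<inter> ?Q"] lt(1) by auto
  then obtain y where y: "y \<in> ?Q \<inter> A" "y \<notin> X" by blast
  \<comment> \<open>Here \<open>s > 0\<close> matters: below the capacity, adding \<open>y\<close>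
    would raise the weight.\<close>
  have "int (card X) = u"
  proof (rule ccontr)
    assume "int (card X) \<noteq> u"
    then have "insert y X \<in> hitting_sets l u A \<B>"
      using X y unfolding hitting_sets_def by auto
    from max[OF this] show False using y assms by simp
  qed
  moreover have "card X = card (X \<inter> ?Q) + card (X - ?Q)"
    by (rule card_union2) auto
  moreover have "card (X - ?Q) \<le> card {B \<in> \<B>. B \<inter> ?Q = {}}"
  proof (rule card_sole_hits_le)
    fix x assume x: "x \<in> X - ?Q"
    then have "x \<in> X" "y \<in> A - X" "a x < a y" using y by auto
    then obtain B where B: "B \<in> \<B>" "X \<inter> B = {x}" by (rule swap_blocked)
    have "j \<notin> ?Q" if "j \<in> B" for j using sole_hit_optimal[OF B that] x by auto
    then have "B \<inter> ?Q = {}" by blast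
    with B show "\<exists>B\<in>{B \<in> \<B>. B \<inter> ?Q = {}}. X \<inter> B = {x}" by blast
  qed
  ultimately show False using lt by linarith
qed

text \<open>If the bound \<open>l - card (A - Q)\<close> is exceeded, every \<open>x\<close> in
  \<open>X \<inter> Q\<close> is the sole hit of some block. This block lies in the level set
  because \<open>x\<close> is heaviest in it.\<close>

lemma maximal_lower_rank:
  assumes "s < 0"
  shows "int (card (X \<inter> {j. a j \<le> s})) \<le> lower_rank l A \<B> {j. a j \<le> s}"
proof (rule ccontr)
  let ?Q = "{j. a j \<le> s}"
  assume "\<not> ?thesis"
  then have gt: "card (X \<inter> ?Q) > card {B \<in> \<B>. B \<subseteq> ?Q}"
      "int (card (X \<inter> ?Q)) > l - int (card (A - ?Q))"
    unfolding lower_rank_def by auto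
  have cX: "card X = card (X \<inter> ?Q) + card (X - ?Q)"
    by (rule card_union2) auto
  have "card (X \<inter> ?Q) \<le> card {B \<in> \<B>. B \<subseteq> ?Q}"
  proof (rule card_sole_hits_le)
    fix x assume x: "x \<in> X \<inter> ?Q"
    have "\<exists>B\<in>\<B>. X \<inter> B = {x}"
    proof (cases "int (card X) = l")
      case True
      then have "card (X - ?Q) < card (A - ?Q)" using gt cX by linarith
      then have "\<not> A - ?Q \<subseteq> X - ?Q" using card_mono[OF finite, of "A - ?Q" "X - ?Q"] by auto
      then obtain y where "y \<in> A - ?Q" "y \<notin> X" by blast
      then have "x \<in> X" "y \<in> A - X" "a x < a y" using x by auto
      then obtain B where "B \<in> \<B>" "X \<inter> B = {x}" by (rule swap_blocked)
      then show ?thesis by blast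
    next
      case False
      show ?thesis
      proof (rule ccontr)
        assume none: "\<not> ?thesis"
        have "(X - {x}) \<inter> B \<noteq> {}" if "B \<in> \<B>" for B
        proof
          assume "(X - {x}) \<inter> B = {}"
          then have "X \<inter> B = {x}" using X that unfolding hitting_sets_def by blast
          with none that show False by blast
        qed
        moreover have "int (card (X - {x})) = int (card X) - 1"
          using card_union2[of X "X - {x}" "{x}"] x by (simp add: insert_absorb)
        ultimately have "X - {x} \<in> hitting_sets l u A \<B>"
          using X False unfolding hitting_sets_def by auto
        from max[OF this] show False using x assms by (simp add: sum_diff1)
      qed
    qed
    then obtain B where B: "B \<in> \<B>" "X \<inter> B = {x}" by blast
    have "j \<in> ?Q" if "j \<in> B" for j using sole_hit_optimal[OF B that] x by auto
    then have "B \<subseteq> ?Q" by blast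
    with B show "\<exists>B\<in>{B \<in> \<B>. B \<subseteq> ?Q}. X \<inter> B = {x}" by blast
  qed
  with gt show False by linarith
qed

end

text \<open>Abel summation: peel off the smallest positive value of \<open>a\<close>.\<close>

lemma weighted_sum_nonpos:
  fixes a w :: "'j::finite \<Rightarrow> real"
  assumes "\<And>s. s > 0 \<Longrightarrow> sum w {j. s \<le> a j} \<le> 0"
  shows "(\<Sum>j\<in>{j. a j > 0}. a j * w j) \<le> 0"
  using assms
proof (induction "card {j. a j > 0}" arbitrary: a rule: less_induct)
  case less
  show ?case
  proof (cases "{j. a j > 0} = {}")
    case True
    then show ?thesis by simp
  next
    case False
    define m where "m = Min (a ` {j. a j > 0})"
    have m_in: "m \<in> a ` {j. a j > 0}" unfolding m_def using False by (intro Min_in) auto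
    then have "m > 0" by auto
    have m_le: "m \<le> a j" if "a j > 0" for j unfolding m_def using that by (intro Min_le) auto
    \<comment> \<open>The shift by \<open>m\<close> moves the level sets by \<open>m\<close> and
      removes the minimisers from the support, so the induction hypothesis applies.\<close>
    let ?b = "\<lambda>j. a j - m"
    have sub: "{j. ?b j > 0} \<subset> {j. a j > 0}" using m_in \<open>m > 0\<close> by auto
    have "(\<Sum>j\<in>{j. ?b j > 0}. ?b j * w j) \<le> 0"
    proof (rule less.hyps)
      show "card {j. ?b j > 0} < card {j. a j > 0}" using sub by (intro psubset_card_mono) auto
      show "sum w {j. s \<le> ?b j} \<le> 0" if "s > 0" for s
        using less.prems[of "s + m"] that \<open>m > 0\<close> by (simp add: algebra_simps)
    qed
    moreover have "(\<Sum>j\<in>{j. ?b j > 0}. ?b j * w j) = (\<Sum>j\<in>{j. a j > 0}. ?b j * w j)"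
      using sub m_le by (intro sum.mono_neutral_left) (auto simp: order_antisym)
    moreover have "(\<Sum>j\<in>{j. a j > 0}. a j * w j)
        = (\<Sum>j\<in>{j. a j > 0}. ?b j * w j) + m * sum w {j. a j > 0}"
      by (simp add: sum_distrib_left flip: sum.distrib) (simp add: algebra_simps)
    moreover have "{j. a j > 0} = {j. m \<le> a j}" using m_le \<open>m > 0\<close> by auto
    then have "m * sum w {j. a j > 0} \<le> 0"
      using less.prems[OF \<open>m > 0\<close>] \<open>m > 0\<close> by (simp add: mult_nonneg_nonpos)
    ultimately show ?thesis by linarith
  qed
qed

text \<open>The negative part of \<open>a\<close> is handled by the same summation for
  \<open>- a\<close> and \<open>- w\<close>, which turns lower level sets into upper ones.\<close>

lemma inner_nonpos_of_level_sets:
  fixes a w :: "'j::finite \<Rightarrow> real"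
  assumes up: "\<And>s. s > 0 \<Longrightarrow> sum w {j. s \<le> a j} \<le> 0"
    and lo: "\<And>s. s < 0 \<Longrightarrow> sum w {j. a j \<le> s} \<ge> 0"
  shows "(\<Sum>j\<in>UNIV. a j * w j) \<le> 0"
proof -
  have "(\<Sum>j\<in>{j. - a j > 0}. - a j * - w j) \<le> 0"
  proof (rule weighted_sum_nonpos)
    fix s :: real assume "s > 0"
    then show "(\<Sum>j\<in>{j. s \<le> - a j}. - w j) \<le> 0"
      using lo[of "- s"] by (simp add: sum_negf le_minus_iff)
  qed
  moreover have "(\<Sum>j\<in>{j. a j > 0}. a j * w j) \<le> 0"
    by (rule weighted_sum_nonpos[OF up])
  moreover have "(\<Sum>j\<in>UNIV. a j * w j)
      = (\<Sum>j\<in>{j. a j > 0} \<union> {j. a j < 0}. a j * w j)"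
    by (rule sum.mono_neutral_right) auto
  moreover have "\<dots> = (\<Sum>j\<in>{j. a j > 0}. a j * w j) + (\<Sum>j\<in>{j. a j < 0}. a j * w j)"
    by (rule sum.union_disjoint) auto
  ultimately show ?thesis by simp
qed

section \<open>Membership in the convex hull by separation\<close>

definition ind_vec :: "'j set \<Rightarrow> real^'j" where
  "ind_vec X = (\<chi> j. if j \<in> X then 1 else 0)"

lemma sum_ind_vec: "(\<Sum>j\<in>Q. ind_vec X $ j) = real (card (X \<inter> Q))" for Q :: "'j::finite set"
  by (simp add: ind_vec_def sum.If_cases Int_commute)

text \<open>Each family of hitting sets spans a generalised polymatroid bounded by its two rank
  functions, and these functions add up under weighted Minkowski sums.\<close>

lemma mixture_in_convex_hull:
  fixes T :: "'t set" and \<mu> :: "'t \<Rightarrow> real" and d :: "'t \<Rightarrow> 'v::euclidean_space"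
    and A :: "'t \<Rightarrow> 'j::finite set" and z :: "real^'j"
  assumes "finite T" and nonneg: "\<And>t. t \<in> T \<Longrightarrow> \<mu> t \<ge> 0" and one: "sum \<mu> T = 1"
    and ne: "\<And>t. t \<in> T \<Longrightarrow> \<mu> t > 0 \<Longrightarrow> hitting_sets l u (A t) (\<B> t) \<noteq> {}"
    and disj: "\<And>t. t \<in> T \<Longrightarrow> disjoint (\<B> t)"
    and sub: "\<And>t B. t \<in> T \<Longrightarrow> B \<in> \<B> t \<Longrightarrow> B \<subseteq> A t"
    and up: "\<And>Q. (\<Sum>j\<in>Q. z $ j) \<le> (\<Sum>t\<in>T. \<mu> t * of_int (upper_rank u (A t) (\<B> t) Q))"
    and lo: "\<And>Q. (\<Sum>t\<in>T. \<mu> t * of_int (lower_rank l (A t) (\<B> t) Q)) \<le> (\<Sum>j\<in>Q. z $ j)"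
  shows "(\<Sum>t\<in>T. \<mu> t *\<^sub>R d t, z) \<in>
    convex hull (\<Union>t\<in>T. (\<lambda>X. (d t, ind_vec X)) ` hitting_sets l u (A t) (\<B> t))"
    (is "?p \<in> convex hull ?V")
proof (rule ccontr)
  assume "?p \<notin> convex hull ?V"
  moreover have "closed (convex hull ?V)"
    using \<open>finite T\<close> by (intro compact_imp_closed finite_imp_compact_convex_hull) auto
  ultimately obtain c b where c: "c \<bullet> ?p < b" "\<And>x. x \<in> convex hull ?V \<Longrightarrow> b < c \<bullet> x"
    using separating_hyperplane_closed_point[OF convex_convex_hull] by blast
  \<comment> \<open>The sign turns minimising the separating functional over the vertices of one
    pattern into maximising the weight \<open>a\<close>.\<close>
  define a where "a j = - (snd c $ j)" for j
  \<comment> \<open>A pattern of weight zero may have no hitting set, so a maximiser is demanded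
    only where \<open>\<mu> t > 0\<close>.\<close>
  have "\<forall>t\<in>T. \<exists>X. \<mu> t > 0 \<longrightarrow> X \<in> hitting_sets l u (A t) (\<B> t) \<and>
      (\<forall>Y\<in>hitting_sets l u (A t) (\<B> t). sum a Y \<le> sum a X)"
  proof
    fix t assume "t \<in> T"
    let ?H = "hitting_sets l u (A t) (\<B> t)"
    have "\<exists>X. X \<in> ?H \<and> (\<forall>Y\<in>?H. sum a Y \<le> sum a X)" if "\<mu> t > 0"
    proof -
      have "Max (sum a ` ?H) \<in> sum a ` ?H" using ne[OF \<open>t \<in> T\<close> that] by (intro Max_in) auto
      then obtain X where "X \<in> ?H" "sum a X = Max (sum a ` ?H)" by force
      then show ?thesis using Max_ge[of "sum a ` ?H"] by auto
    qed
    then show "\<exists>X. \<mu> t > 0 \<longrightarrow> X \<in> ?H \<and> (\<forall>Y\<in>?H. sum a Y \<le> sum a X)" by blast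
  qed
  from bchoice[OF this] obtain X
    where X: "\<And>t. t \<in> T \<Longrightarrow> \<mu> t > 0 \<Longrightarrow> X t \<in> hitting_sets l u (A t) (\<B> t)"
      "\<And>t Y. t \<in> T \<Longrightarrow> \<mu> t > 0 \<Longrightarrow> Y \<in> hitting_sets l u (A t) (\<B> t) \<Longrightarrow> sum a Y \<le> sum a (X t)"
    by blast
  \<comment> \<open>\<open>w\<close> is the deviation of \<open>z\<close> from the mixture of the
    maximisers. The rank bounds control its sums over level sets, so the functional \<open>c\<close>
    is at \<open>?p\<close> at least as large as at the mixture, hence at least
    \<open>b\<close>.\<close>
  define w where "w j = z $ j - (\<Sum>t\<in>T. \<mu> t * ind_vec (X t) $ j)" for j
  have sum_w: "sum w Q = (\<Sum>j\<in>Q. z $ j) - (\<Sum>t\<in>T. \<mu> t * real (card (X t \<inter> Q)))" for Q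
    unfolding w_def sum_subtractf
    by (subst sum.swap) (simp add: sum_ind_vec flip: sum_distrib_left)
  have "(\<Sum>j\<in>UNIV. a j * w j) \<le> 0"
  proof (rule inner_nonpos_of_level_sets)
    fix s :: real assume "s > 0"
    let ?Q = "{j. s \<le> a j}"
    have "(\<Sum>t\<in>T. \<mu> t * of_int (upper_rank u (A t) (\<B> t) ?Q)) \<le> (\<Sum>t\<in>T. \<mu> t * real (card (X t \<inter> ?Q)))"
    proof (rule sum_mono)
      fix t assume t: "t \<in> T"
      show "\<mu> t * of_int (upper_rank u (A t) (\<B> t) ?Q) \<le> \<mu> t * real (card (X t \<inter> ?Q))"
      proof (cases "\<mu> t > 0")
        case True
        have "upper_rank u (A t) (\<B> t) ?Q \<le> int (card (X t \<inter> ?Q))"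
          by (rule maximal_upper_rank[OF disj sub X \<open>s > 0\<close>]) (use t True in auto)
        then show ?thesis using True by simp
      qed (use nonneg[OF t] in simp)
    qed
    then show "sum w ?Q \<le> 0" using up[of ?Q] unfolding sum_w by linarith
  next
    fix s :: real assume "s < 0"
    let ?Q = "{j. a j \<le> s}"
    have "(\<Sum>t\<in>T. \<mu> t * real (card (X t \<inter> ?Q))) \<le> (\<Sum>t\<in>T. \<mu> t * of_int (lower_rank l (A t) (\<B> t) ?Q))"
    proof (rule sum_mono)
      fix t assume t: "t \<in> T"
      show "\<mu> t * real (card (X t \<inter> ?Q)) \<le> \<mu> t * of_int (lower_rank l (A t) (\<B> t) ?Q)"
      proof (cases "\<mu> t > 0")
        case True
        have "int (card (X t \<inter> ?Q)) \<le> lower_rank l (A t) (\<B> t) ?Q"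
          by (rule maximal_lower_rank[OF disj sub X \<open>s < 0\<close>]) (use t True in auto)
        then show ?thesis using True by simp
      qed (use nonneg[OF t] in simp)
    qed
    then show "0 \<le> sum w ?Q" using lo[of ?Q] unfolding sum_w by linarith
  qed
  moreover have "a j * w j = (\<Sum>t\<in>T. \<mu> t * (snd c $ j * ind_vec (X t) $ j)) - snd c $ j * z $ j" for j
    unfolding w_def a_def by (simp add: right_diff_distrib sum_distrib_left sum_negf mult.left_commute)
  then have "(\<Sum>j\<in>UNIV. a j * w j) = (\<Sum>t\<in>T. \<mu> t * (snd c \<bullet> ind_vec (X t))) - snd c \<bullet> z"
    unfolding inner_vec_def inner_real_def sum_distrib_left
    by (subst sum.swap) (simp add: sum_subtractf)
  ultimately have "(\<Sum>t\<in>T. \<mu> t * (snd c \<bullet> ind_vec (X t))) \<le> snd c \<bullet> z" by simp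
  then have "(\<Sum>t\<in>T. \<mu> t * (c \<bullet> (d t, ind_vec (X t)))) \<le> c \<bullet> ?p"
    by (simp add: inner_prod_def inner_sum_right distrib_left sum.distrib)
  moreover have "(\<Sum>t\<in>T. \<mu> t * b) \<le> (\<Sum>t\<in>T. \<mu> t * (c \<bullet> (d t, ind_vec (X t))))"
  proof (rule sum_mono)
    fix t assume t: "t \<in> T"
    show "\<mu> t * b \<le> \<mu> t * (c \<bullet> (d t, ind_vec (X t)))"
    proof (cases "\<mu> t > 0")
      case True
      then have "(d t, ind_vec (X t)) \<in> ?V" using X(1) t by blast
      then have "b < c \<bullet> (d t, ind_vec (X t))" by (intro c(2) hull_inc)
      with True show ?thesis by simp
    qed (use nonneg[OF t] in simp)
  qed
  moreover have "(\<Sum>t\<in>T. \<mu> t * b) = b" using one by (simp flip: sum_distrib_right)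
  ultimately show False using c(1) by linarith
qed

section \<open>The inequalities (C) and (D) in terms of region cardinalities\<close>

lemma all_pairs_12:
  "(\<forall>i k::4. {i, k} = {1, 2} \<and> P i k \<longrightarrow> R i k) \<longleftrightarrow> (P 1 2 \<longrightarrow> R 1 2) \<and> (P 2 1 \<longrightarrow> R 2 1)"
  by (auto simp: doubleton_eq_iff)

lemma card_union3:
  fixes B :: "'j::finite set"
  assumes "A = B \<union> C \<union> D" "B \<inter> C = {}" "(B \<union> C) \<inter> D = {}"
  shows "card A = card B + card C + card D"
  using assms by (simp add: card_Un_disjoint)

lemma card_complement_eq:
  fixes A :: "'j::finite set"
  assumes "B = - A"
  shows "int (card A) = int CARD('j) - int (card B)"
  using card_union2[of UNIV A B] assms by simp

text \<open>Splitting \<open>Q\<close> along the regions leaves only its sum and three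
  cardinalities, which makes the later case analysis linear arithmetic. In the third family the
  condition on \<open>Q\<close> removes one cardinality, so only \<open>q3\<close> remains in the
  coefficient.\<close>

lemma upper_ineqs_iff:
  fixes Q S1 S2 :: "'j::finite set" and z :: "real^'j"
  defines "q1 \<equiv> int (card (Q \<inter> (S1 - S2)))" and "q2 \<equiv> int (card (Q \<inter> (S2 - S1)))"
    and "q3 \<equiv> int (card (Q - (S1 \<union> S2)))" and "s \<equiv> (\<Sum>j\<in>Q. z $ j)"
  shows "upper_ineqs u S1 S2 \<delta> z Q \<longleftrightarrow>
    (q1 + q2 + q3 \<le> u \<longrightarrow>
       s + of_int (u - (q1 + q2 + q3)) * \<delta> $ 0 + of_int q1 * \<delta> $ 1 + of_int q2 * \<delta> $ 2 \<le> of_int u) \<and>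
    s + of_int (u - (q2 + q3)) * \<delta> $ 1 + of_int (u - (q1 + q3)) * \<delta> $ 2
      + of_int (q1 + q2 + q3 - u) * \<delta> $ 3 \<le> of_int u \<and>
    (q1 = 0 \<longrightarrow>
       s + \<delta> $ 0 - \<delta> $ 1 + of_int (u - 1 - q3) * \<delta> $ 2 + \<delta> $ 3 \<le> of_int u) \<and>
    (q2 = 0 \<longrightarrow>
       s + \<delta> $ 0 - \<delta> $ 2 + of_int (u - 1 - q3) * \<delta> $ 1 + \<delta> $ 3 \<le> of_int u) \<and>
    (q2 + q3 \<le> u \<longrightarrow> s + of_int (u - (q2 + q3)) * \<delta> $ 1 + of_int q2 * \<delta> $ 3 \<le> of_int u) \<and>
    (q1 + q3 \<le> u \<longrightarrow> s + of_int (u - (q1 + q3)) * \<delta> $ 2 + of_int q1 * \<delta> $ 3 \<le> of_int u) \<and>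
    (q3 \<le> u \<longrightarrow> s + of_int (u - q3) * \<delta> $ 3 \<le> of_int u)"
proof -
  have c0: "int (card (Q - S1 \<inter> S2)) = q1 + q2 + q3"
    unfolding q1_def q2_def q3_def of_nat_add[symmetric] of_nat_eq_iff by (rule card_union3) auto
  have c1: "int (card (Q - S1)) = q2 + q3"
    unfolding q2_def q3_def of_nat_add[symmetric] of_nat_eq_iff by (rule card_union2) auto
  have c2: "int (card (Q - S2)) = q1 + q3"
    unfolding q1_def q3_def of_nat_add[symmetric] of_nat_eq_iff by (rule card_union2) auto
  have r: "real (card (Q - S1)) = of_int (q2 + q3)" "real (card (Q - S2)) = of_int (q1 + q3)"
    "real (card (Q \<inter> (S1 - S2))) = of_int q1" "real (card (Q \<inter> (S2 - S1))) = of_int q2"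
    using c1 c2 q1_def q2_def by linarith+
  have e: "Q \<inter> S1 - S1 \<inter> S2 = Q \<inter> (S1 - S2)" "Q \<inter> S2 - S1 \<inter> S2 = Q \<inter> (S2 - S1)"
    "Q \<inter> (S1 \<union> S2) - S1 = Q \<inter> (S2 - S1)" "Q \<inter> (S1 \<union> S2) - S2 = Q \<inter> (S1 - S2)"
    "S1 - S1 \<inter> S2 = S1 - S2" "S2 - S1 \<inter> S2 = S2 - S1" by auto
  have z1: "Q \<inter> (S1 - S2) = {} \<longleftrightarrow> q1 = 0" and z2: "Q \<inter> (S2 - S1) = {} \<longleftrightarrow> q2 = 0"
    unfolding q1_def q2_def by auto
  show ?thesis
    unfolding upper_ineqs_def Let_def all_pairs_12
    by (simp add: term_set_def e r c0 c1 c2 z1 z2 flip: q1_def q2_def q3_def s_def)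
      (intro conj_cong imp_cong; auto simp: algebra_simps)
qed

text \<open>Passing to complements, \<open>n - card (Q \<union> S)\<close> counts the elements
  outside \<open>S\<close> that \<open>Q\<close> misses; the \<open>m\<close>'s are these counts by
  region.\<close>

lemma lower_ineqs_iff:
  fixes Q S1 S2 :: "'j::finite set" and z :: "real^'j"
  defines "m1 \<equiv> int (card (S1 - S2 - Q))" and "m2 \<equiv> int (card (S2 - S1 - Q))"
    and "m3 \<equiv> int (card (- (S1 \<union> S2) - Q))" and "s \<equiv> (\<Sum>j\<in>Q. z $ j)"
  shows "lower_ineqs l S1 S2 \<delta> z Q \<longleftrightarrow>
    (m1 + m2 + m3 \<le> l \<longrightarrow>
       of_int (l - (m1 + m2 + m3)) * \<delta> $ 0 + of_int m1 * \<delta> $ 1 + of_int m2 * \<delta> $ 2 \<le> s) \<and>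
    of_int (l - (m2 + m3)) * \<delta> $ 1 + of_int (l - (m1 + m3)) * \<delta> $ 2
      + of_int (m1 + m2 + m3 - l) * \<delta> $ 3 \<le> s \<and>
    (m1 = 0 \<longrightarrow> \<delta> $ 0 - \<delta> $ 1 + of_int (l - 1 - m3) * \<delta> $ 2 + \<delta> $ 3 \<le> s) \<and>
    (m2 = 0 \<longrightarrow> \<delta> $ 0 - \<delta> $ 2 + of_int (l - 1 - m3) * \<delta> $ 1 + \<delta> $ 3 \<le> s) \<and>
    (m2 + m3 \<le> l \<longrightarrow> of_int (l - (m2 + m3)) * \<delta> $ 1 + of_int m2 * \<delta> $ 3 \<le> s) \<and>
    (m1 + m3 \<le> l \<longrightarrow> of_int (l - (m1 + m3)) * \<delta> $ 2 + of_int m1 * \<delta> $ 3 \<le> s) \<and>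
    (m3 \<le> l \<longrightarrow> of_int (l - m3) * \<delta> $ 3 \<le> s)"
proof -
  let ?n = "int CARD('j)"
  have "card (- (Q \<union> S1 \<inter> S2)) = card (S1 - S2 - Q) + card (S2 - S1 - Q) + card (- (S1 \<union> S2) - Q)"
    by (rule card_union3) auto
  then have c0: "int (card (Q \<union> S1 \<inter> S2)) = ?n - (m1 + m2 + m3)"
    unfolding m1_def m2_def m3_def by (subst card_complement_eq[OF refl]) simp
  have "card (- (Q \<union> S1)) = card (S2 - S1 - Q) + card (- (S1 \<union> S2) - Q)"
    by (rule card_union2) auto
  then have c1: "int (card (Q \<union> S1)) = ?n - (m2 + m3)"
    unfolding m2_def m3_def by (subst card_complement_eq[OF refl]) simp
  have "card (- (Q \<union> S2)) = card (S1 - S2 - Q) + card (- (S1 \<union> S2) - Q)"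
    by (rule card_union2) auto
  then have c2: "int (card (Q \<union> S2)) = ?n - (m1 + m3)"
    unfolding m1_def m3_def by (subst card_complement_eq[OF refl]) simp
  have c3: "int (card (Q \<union> (S1 \<union> S2))) = ?n - m3"
    unfolding m3_def by (rule card_complement_eq) auto
  have r: "real (card (Q \<union> S1)) = real CARD('j) - of_int (m2 + m3)"
    "real (card (Q \<union> S2)) = real CARD('j) - of_int (m1 + m3)"
    "real (card (S1 - S2 - Q)) = of_int m1" "real (card (S2 - S1 - Q)) = of_int m2"
    using c1 c2 m1_def m2_def by linarith+
  have e: "S1 - (S1 \<inter> S2 \<union> Q) = S1 - S2 - Q" "S2 - (S1 \<inter> S2 \<union> Q) = S2 - S1 - Q"
    "S1 \<union> S2 - (S1 \<union> Q) = S2 - S1 - Q" "S1 \<union> S2 - (S2 \<union> Q) = S1 - S2 - Q"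
    "S1 - S1 \<inter> S2 = S1 - S2" "S2 - S1 \<inter> S2 = S2 - S1" by auto
  have z1: "S1 - S2 \<subseteq> Q \<longleftrightarrow> m1 = 0" and z2: "S2 - S1 \<subseteq> Q \<longleftrightarrow> m2 = 0"
    unfolding m1_def m2_def by auto
  show ?thesis
    unfolding lower_ineqs_def Let_def all_pairs_12
    by (simp add: term_set_def e r c0 c1 c2 c3 z1 z2 flip: m1_def m2_def m3_def s_def)
      (intro conj_cong imp_cong; auto simp: algebra_simps)
qed

lemma sum_Un_regions:
  fixes f :: "'j::finite \<Rightarrow> real"
  shows "sum f Q = sum f (Q \<inter> (S1 \<inter> S2)) + sum f (Q \<inter> (S1 - S2)) + sum f (Q \<inter> (S2 - S1))
    + sum f (Q - (S1 \<union> S2))"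
proof -
  have "Q = (Q \<inter> (S1 \<inter> S2) \<union> Q \<inter> (S1 - S2)) \<union> (Q \<inter> (S2 - S1) \<union> (Q - (S1 \<union> S2)))" by blast
  then have "sum f Q = sum f ((Q \<inter> (S1 \<inter> S2) \<union> Q \<inter> (S1 - S2)) \<union> (Q \<inter> (S2 - S1) \<union> (Q - (S1 \<union> S2))))"
    by (rule arg_cong)
  also have "\<dots> = sum f (Q \<inter> (S1 \<inter> S2) \<union> Q \<inter> (S1 - S2)) + sum f (Q \<inter> (S2 - S1) \<union> (Q - (S1 \<union> S2)))"
    by (rule sum.union_disjoint) auto
  also have "sum f (Q \<inter> (S1 \<inter> S2) \<union> Q \<inter> (S1 - S2)) = sum f (Q \<inter> (S1 \<inter> S2)) + sum f (Q \<inter> (S1 - S2))"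
    by (rule sum.union_disjoint) auto
  also have "sum f (Q \<inter> (S2 - S1) \<union> (Q - (S1 \<union> S2))) = sum f (Q \<inter> (S2 - S1)) + sum f (Q - (S1 \<union> S2))"
    by (rule sum.union_disjoint) auto
  finally show ?thesis by simp
qed

section \<open>Bounds on \<open>zsum Q\<close> for a point of the polyhedron\<close>

locale polyhedron_point =
  fixes l u :: int and S1 S2 :: "'j::finite set" and \<delta> :: "real^4" and z :: "real^'j"
  assumes u2: "2 \<le> u"
    and ne1: "S1 - S2 \<noteq> {}" and ne2: "S2 - S1 \<noteq> {}"
    and delta_ineqs: "delta_ineqs \<delta>" and basic_ineqs: "basic_ineqs l u S1 S2 \<delta> z"
    and upper_ineqs: "\<And>Q. upper_ineqs u S1 S2 \<delta> z Q"
    and lower_ineqs: "\<And>Q. lower_ineqs l S1 S2 \<delta> z Q"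
begin

abbreviation zsum :: "'j set \<Rightarrow> real" where "zsum Q \<equiv> (\<Sum>j\<in>Q. z $ j)"

lemma delta:
  "\<delta> $ 0 \<le> 1" "0 \<le> \<delta> $ 3" "\<delta> $ 3 \<le> \<delta> $ 1" "\<delta> $ 3 \<le> \<delta> $ 2" "\<delta> $ 1 + \<delta> $ 2 \<le> \<delta> $ 0 + \<delta> $ 3"
  using delta_ineqs unfolding delta_ineqs_def by auto

lemma z_bounds: "0 \<le> z $ j" "z $ j \<le> 1"
    "j \<in> S1 \<inter> S2 \<Longrightarrow> z $ j \<le> 1 - \<delta> $ 0" "j \<in> S1 \<Longrightarrow> z $ j \<le> 1 - \<delta> $ 1" "j \<in> S2 \<Longrightarrow> z $ j \<le> 1 - \<delta> $ 2"
  using basic_ineqs unfolding basic_ineqs_def Let_def term_set_def by (auto simp: le_diff_eq)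

lemma zsum_bounds:
    "zsum UNIV \<le> u" "l \<le> zsum UNIV" "1 - \<delta> $ 0 \<le> zsum (S1 \<inter> S2)"
    "\<delta> $ 0 - \<delta> $ 1 \<le> zsum (S1 - S2)" "\<delta> $ 0 - \<delta> $ 2 \<le> zsum (S2 - S1)"
proof -
  have "S1 - S1 \<inter> S2 = S1 - S2" "S2 - S1 \<inter> S2 = S2 - S1" by auto
  then show "zsum UNIV \<le> u" "l \<le> zsum UNIV" "1 - \<delta> $ 0 \<le> zsum (S1 \<inter> S2)"
    "\<delta> $ 0 - \<delta> $ 1 \<le> zsum (S1 - S2)" "\<delta> $ 0 - \<delta> $ 2 \<le> zsum (S2 - S1)"
    using basic_ineqs unfolding basic_ineqs_def Let_def term_set_def by auto
qed

lemma zsum_nonneg: "0 \<le> zsum Q"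
  by (simp add: sum_nonneg z_bounds)

lemma zsum_union: "Q \<inter> R = {} \<Longrightarrow> zsum (Q \<union> R) = zsum Q + zsum R"
  by (simp add: sum.union_disjoint)

lemma zsum_mono: "Q \<subseteq> R \<Longrightarrow> zsum Q \<le> zsum R"
  by (simp add: sum_mono2 z_bounds)

text \<open>Each \<open>z $ j\<close> is bounded by its cap from (B). The cap of a region is the
  total weight of the patterns whose support contains it, so this is the mixture of the upper ranks
  when no capacity binds.\<close>

lemma zsum_le_caps:
  "zsum Q \<le> real (card (Q \<inter> (S1 \<inter> S2))) * (1 - \<delta> $ 0) + real (card (Q \<inter> (S1 - S2))) * (1 - \<delta> $ 1)
    + real (card (Q \<inter> (S2 - S1))) * (1 - \<delta> $ 2) + real (card (Q - (S1 \<union> S2)))"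
proof -
  have "zsum (Q \<inter> (S1 \<inter> S2)) \<le> real (card (Q \<inter> (S1 \<inter> S2))) * (1 - \<delta> $ 0)"
    by (rule sum_bounded_above) (auto simp: z_bounds)
  moreover have "zsum (Q \<inter> (S1 - S2)) \<le> real (card (Q \<inter> (S1 - S2))) * (1 - \<delta> $ 1)"
    by (rule sum_bounded_above) (auto simp: z_bounds)
  moreover have "zsum (Q \<inter> (S2 - S1)) \<le> real (card (Q \<inter> (S2 - S1))) * (1 - \<delta> $ 2)"
    by (rule sum_bounded_above) (auto simp: z_bounds)
  moreover have "zsum (Q - (S1 \<union> S2)) \<le> real (card (Q - (S1 \<union> S2))) * 1"
    by (rule sum_bounded_above) (auto simp: z_bounds)
  ultimately show ?thesis using sum_Un_regions[of "\<lambda>j. z $ j" Q S1 S2] by linarith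
qed

text \<open>The pattern \<open>\<delta> = 0\<close> is counted here with full capacity \<open>u\<close>, because the inequalities (C) bound it
  in this way. When \<open>Q\<close> misses a block, the bound for \<open>Q\<close> can also follow by adding the block to \<open>Q\<close>
  and subtracting its lower bound from (B).\<close>

lemma zsum_upper_core:
  fixes Q
  defines "q1 \<equiv> int (card (Q \<inter> (S1 - S2)))" and "q2 \<equiv> int (card (Q \<inter> (S2 - S1)))"
    and "q3 \<equiv> int (card (Q - (S1 \<union> S2)))"
  shows "zsum Q \<le> of_int u * (1 - \<delta> $ 0)
    + of_int (min (q1 + q2 + q3) (u - (of_bool (q1 = 0) + of_bool (q2 = 0)))) * (\<delta> $ 0 + \<delta> $ 3 - \<delta> $ 1 - \<delta> $ 2)
    + of_int (min (q2 + q3) (u - of_bool (q2 = 0))) * (\<delta> $ 1 - \<delta> $ 3)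
    + of_int (min (q1 + q3) (u - of_bool (q1 = 0))) * (\<delta> $ 2 - \<delta> $ 3)
    + of_int (min q3 u) * \<delta> $ 3"
    (is "_ \<le> _ + of_int ?rc * _ + of_int ?r1 * _ + of_int ?r2 * _ + of_int ?r3 * _")
proof -
  have nn: "0 \<le> q1" "0 \<le> q2" "0 \<le> q3" unfolding q1_def q2_def q3_def by auto
  note C = iffD1[OF upper_ineqs_iff upper_ineqs[of Q], folded q1_def q2_def q3_def]
  have zR: "zsum (Q \<union> R) = zsum Q + zsum R" if "card (Q \<inter> R) = 0" for R
    using that by (intro zsum_union) simp
  \<comment> \<open>The cases record which blocks \<open>Q\<close> misses and whether the capacity
    binds in the pattern with only \<open>\<delta> $ 0 = 1\<close>. In \<open>full\<close> it does
    not, so the patterns of smaller support are uncapped too and the first family of (C) is the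
    claim.\<close>
  consider (full) "q1 + q2 + q3 \<le> u - (of_bool (q1 = 0) + of_bool (q2 = 0))"
    | (miss12) "q1 = 0" "q2 = 0" "q3 > u - 2"
    | (miss1) "q1 = 0" "q2 > 0" "q2 + q3 \<ge> u"
    | (miss2) "q1 > 0" "q2 = 0" "q1 + q3 \<ge> u"
    | (hit) "q1 > 0" "q2 > 0" "q1 + q2 + q3 > u"
  proof (cases "q1 = 0"; cases "q2 = 0")
    assume "q1 = 0" "q2 = 0"
    then show ?thesis using full miss12 by (cases "q3 > u - 2") auto
  next
    assume "q1 = 0" "q2 \<noteq> 0"
    then show ?thesis using full miss1 nn by (cases "q2 + q3 \<ge> u") auto
  next
    assume "q1 \<noteq> 0" "q2 = 0"
    then show ?thesis using full miss2 nn by (cases "q1 + q3 \<ge> u") auto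
  next
    assume "q1 \<noteq> 0" "q2 \<noteq> 0"
    then show ?thesis using full hit nn by (cases "q1 + q2 + q3 > u") auto
  qed
  then show ?thesis
  proof cases
    case full
    have r: "?rc = q1 + q2 + q3" "?r1 = q2 + q3" "?r2 = q1 + q3" "?r3 = q3"
      using full nn by (auto simp: of_bool_def split: if_splits)
    have "q1 + q2 + q3 \<le> u" using full by (auto simp: of_bool_def split: if_splits)
    then show ?thesis using C unfolding r by (simp add: algebra_simps)
  next
    case hit
    then have rc: "?rc = u" by simp
    \<comment> \<open>In this order the bound is the second family of (C), the fourth for
      \<open>i = 1\<close> and for \<open>i = 2\<close>, the fifth, and the total bound
      \<open>u\<close>.\<close>
    consider "q2 + q3 \<le> u" "q1 + q3 \<le> u" | "q2 + q3 \<le> u" "q1 + q3 > u"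
      | "q2 + q3 > u" "q1 + q3 \<le> u" | "q2 + q3 > u" "q1 + q3 > u" "q3 \<le> u" | "q3 > u"
      by linarith
    then show ?thesis
    proof cases
      case 1
      then have r: "?r1 = q2 + q3" "?r2 = q1 + q3" "?r3 = q3" using hit by auto
      show ?thesis using C unfolding rc r by (simp add: algebra_simps)
    next
      case 2
      then have r: "?r1 = q2 + q3" "?r2 = u" "?r3 = q3" using hit by auto
      show ?thesis using C 2 unfolding rc r by (simp add: algebra_simps)
    next
      case 3
      then have r: "?r1 = u" "?r2 = q1 + q3" "?r3 = q3" using hit by auto
      show ?thesis using C 3 unfolding rc r by (simp add: algebra_simps)
    next
      case 4
      then have r: "?r1 = u" "?r2 = u" "?r3 = q3" using hit by auto
      show ?thesis using C 4 unfolding rc r by (simp add: algebra_simps)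
    next
      case 5
      then have r: "?r1 = u" "?r2 = u" "?r3 = u" using hit by auto
      show ?thesis using zsum_mono[of Q UNIV] zsum_bounds(1) unfolding rc r by (simp add: algebra_simps)
    qed
  next
    case miss1
    then have rc: "?rc = u - 1" "?r1 = u" by auto
    show ?thesis
    \<comment> \<open>Up to \<open>u - 1\<close> the claim is the third family of (C) for
      \<open>i = 1\<close>, whose condition is \<open>q1 = 0\<close>.\<close>
    proof (cases "q3 \<le> u - 1")
      case True
      then have r: "?r2 = q3" "?r3 = q3" using miss1 by auto
      show ?thesis using C miss1 unfolding rc r by (simp add: algebra_simps)
    next
      case False
      then have r: "?r2 = u - 1" "?r3 = u" using miss1 by auto
      have "zsum Q + zsum (S1 - S2) \<le> u"
        using zR[of "S1 - S2"] miss1(1) zsum_mono[of "Q \<union> (S1 - S2)" UNIV] zsum_bounds(1)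
        unfolding q1_def by simp
      then show ?thesis using zsum_bounds(4) unfolding rc r by (simp add: algebra_simps)
    qed
  next
    case miss2
    then have rc: "?rc = u - 1" "?r2 = u" by auto
    show ?thesis
    proof (cases "q3 \<le> u - 1")
      case True
      then have r: "?r1 = q3" "?r3 = q3" using miss2 by auto
      show ?thesis using C miss2 unfolding rc r by (simp add: algebra_simps)
    next
      case False
      then have r: "?r1 = u - 1" "?r3 = u" using miss2 by auto
      have "zsum Q + zsum (S2 - S1) \<le> u"
        using zR[of "S2 - S1"] miss2(2) zsum_mono[of "Q \<union> (S2 - S1)" UNIV] zsum_bounds(1)
        unfolding q2_def by simp
      then show ?thesis using zsum_bounds(5) unfolding rc r by (simp add: algebra_simps)
    qed
  next
    case miss12
    then have rc: "?rc = u - 2" "?r1 = u - 1" "?r2 = u - 1" by auto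
    have z1: "zsum (Q \<union> (S1 - S2)) = zsum Q + zsum (S1 - S2)"
      using zR[of "S1 - S2"] miss12(1) unfolding q1_def by simp
    show ?thesis
    proof (cases "q3 \<le> u - 1")
      case True
      then have q3: "q3 = u - 1" using miss12 by simp
      then have r: "?r3 = u - 1" by simp
      have e: "(Q \<union> (S1 - S2)) \<inter> (S2 - S1) = Q \<inter> (S2 - S1)" "Q \<union> (S1 - S2) - (S1 \<union> S2) = Q - (S1 \<union> S2)"
        by auto
      \<comment> \<open>Only one block is added to \<open>Q\<close>; the third family of (C) for
        \<open>i = 2\<close> accounts for the other, and its coefficient \<open>u - 1 - q3\<close>
        is zero here.\<close>
      have "zsum Q + zsum (S1 - S2) + \<delta> $ 0 - \<delta> $ 2 + \<delta> $ 3 \<le> u"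
        using iffD1[OF upper_ineqs_iff upper_ineqs[of "Q \<union> (S1 - S2)"], unfolded e z1,
            folded q2_def q3_def] miss12(2) q3 by simp
      then show ?thesis using zsum_bounds(4) unfolding rc r by (simp add: algebra_simps)
    next
      case False
      then have r: "?r3 = u" by simp
      have "(Q \<union> (S1 - S2)) \<inter> (S2 - S1) = {}" using miss12(2) unfolding q2_def by auto
      then have "zsum Q + zsum (S1 - S2) + zsum (S2 - S1) \<le> u"
        using z1 zsum_union[of "Q \<union> (S1 - S2)" "S2 - S1"] zsum_bounds(1)
          zsum_mono[of "Q \<union> (S1 - S2) \<union> (S2 - S1)" UNIV] by simp
      then show ?thesis using zsum_bounds(4,5) unfolding rc r by (simp add: algebra_simps)
    qed
  qed
qed

text \<open>This restores the true rank of the pattern \<open>\<delta> = 0\<close>. If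
  \<open>Q\<close> misses \<open>S1 \<inter> S2\<close>, the core bound is applied to
  \<open>Q \<union> S1 \<inter> S2\<close>, and the lower bound \<open>1 - \<delta> $ 0\<close> on
  the added sum lowers \<open>u\<close> to \<open>u - 1\<close>.\<close>

lemma zsum_upper:
  fixes Q
  defines "q0 \<equiv> int (card (Q \<inter> (S1 \<inter> S2)))" and "q1 \<equiv> int (card (Q \<inter> (S1 - S2)))"
    and "q2 \<equiv> int (card (Q \<inter> (S2 - S1)))" and "q3 \<equiv> int (card (Q - (S1 \<union> S2)))"
  shows "zsum Q \<le> of_int (min (q0 + q1 + q2 + q3) (u - of_bool (q0 = 0))) * (1 - \<delta> $ 0)
    + of_int (min (q1 + q2 + q3) (u - (of_bool (q1 = 0) + of_bool (q2 = 0)))) * (\<delta> $ 0 + \<delta> $ 3 - \<delta> $ 1 - \<delta> $ 2)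
    + of_int (min (q2 + q3) (u - of_bool (q2 = 0))) * (\<delta> $ 1 - \<delta> $ 3)
    + of_int (min (q1 + q3) (u - of_bool (q1 = 0))) * (\<delta> $ 2 - \<delta> $ 3)
    + of_int (min q3 u) * \<delta> $ 3"
    (is "_ \<le> of_int ?r0 * _ + of_int ?rc * _ + of_int ?r1 * _ + of_int ?r2 * _ + of_int ?r3 * _")
proof -
  have nn: "0 \<le> q0" "0 \<le> q1" "0 \<le> q2" "0 \<le> q3" unfolding q0_def q1_def q2_def q3_def by auto
  consider (slack) "q0 + q1 + q2 + q3 < u - of_bool (q0 = 0)"
    | (miss) "q0 = 0" "?r0 = u - 1" | (hit) "?r0 = u"
    using nn by (cases "q0 = 0"; cases "q0 + q1 + q2 + q3 < u - of_bool (q0 = 0)") auto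
  then show ?thesis
  proof cases
    case slack
    \<comment> \<open>Strictness gives \<open>q1 + q2 + q3 \<le> u - 2\<close>, whether
      \<open>q0\<close> is zero or not, so even two missed blocks leave the other patterns
      uncapped.\<close>
    have r: "?r0 = q0 + q1 + q2 + q3" "?rc = q1 + q2 + q3" "?r1 = q2 + q3" "?r2 = q1 + q3" "?r3 = q3"
      using slack nn by (auto simp: of_bool_def split: if_splits)
    have "zsum Q \<le> of_int q0 * (1 - \<delta> $ 0) + of_int q1 * (1 - \<delta> $ 1) + of_int q2 * (1 - \<delta> $ 2) + of_int q3"
      using zsum_le_caps[of Q] unfolding q0_def q1_def q2_def q3_def by simp
    then show ?thesis unfolding r by (simp add: algebra_simps)
  next
    case hit
    show ?thesis using zsum_upper_core[of Q, folded q1_def q2_def q3_def] unfolding hit .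
  next
    case miss
    have e: "(Q \<union> S1 \<inter> S2) \<inter> (S1 - S2) = Q \<inter> (S1 - S2)" "(Q \<union> S1 \<inter> S2) \<inter> (S2 - S1) = Q \<inter> (S2 - S1)"
      "Q \<union> S1 \<inter> S2 - (S1 \<union> S2) = Q - (S1 \<union> S2)" by auto
    have "Q \<inter> (S1 \<inter> S2) = {}" using miss(1) unfolding q0_def by simp
    from zsum_union[OF this] show ?thesis
      using zsum_upper_core[of "Q \<union> S1 \<inter> S2", unfolded e, folded q1_def q2_def q3_def] zsum_bounds(3)
      unfolding miss(2) by (simp add: algebra_simps)
  qed
qed

text \<open>Mirror image of the upper core: the pattern \<open>\<delta> = 0\<close> is counted with
  rank 0, and a block contained in \<open>Q\<close> may be removed from \<open>Q\<close>, its sum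
  being bounded below by (B).\<close>

lemma zsum_lower_core:
  fixes Q
  defines "m1 \<equiv> int (card (S1 - S2 - Q))" and "m2 \<equiv> int (card (S2 - S1 - Q))"
    and "m3 \<equiv> int (card (- (S1 \<union> S2) - Q))"
  shows "of_int (max (of_bool (m1 = 0) + of_bool (m2 = 0)) (l - (m1 + m2 + m3))) * (\<delta> $ 0 + \<delta> $ 3 - \<delta> $ 1 - \<delta> $ 2)
    + of_int (max (of_bool (m2 = 0)) (l - (m2 + m3))) * (\<delta> $ 1 - \<delta> $ 3)
    + of_int (max (of_bool (m1 = 0)) (l - (m1 + m3))) * (\<delta> $ 2 - \<delta> $ 3)
    + of_int (max 0 (l - m3)) * \<delta> $ 3 \<le> zsum Q"
    (is "of_int ?rc * _ + of_int ?r1 * _ + of_int ?r2 * _ + of_int ?r3 * _ \<le> _")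
proof -
  have nn: "0 \<le> m1" "0 \<le> m2" "0 \<le> m3" unfolding m1_def m2_def m3_def by auto
  note D = iffD1[OF lower_ineqs_iff lower_ineqs[of Q], folded m1_def m2_def m3_def]
  consider (forced) "of_bool (m1 = 0) + of_bool (m2 = 0) \<le> l - (m1 + m2 + m3)"
    | (contain12) "m1 = 0" "m2 = 0" "l - m3 < 2"
    | (contain1) "m1 = 0" "m2 > 0" "l \<le> m2 + m3"
    | (contain2) "m1 > 0" "m2 = 0" "l \<le> m1 + m3"
    | (proper) "m1 > 0" "m2 > 0" "l < m1 + m2 + m3"
  proof (cases "m1 = 0"; cases "m2 = 0")
    assume "m1 = 0" "m2 = 0"
    then show ?thesis using forced contain12 by (cases "l - m3 < 2") auto
  next
    assume "m1 = 0" "m2 \<noteq> 0"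
    then show ?thesis using forced contain1 nn by (cases "l \<le> m2 + m3") auto
  next
    assume "m1 \<noteq> 0" "m2 = 0"
    then show ?thesis using forced contain2 nn by (cases "l \<le> m1 + m3") auto
  next
    assume "m1 \<noteq> 0" "m2 \<noteq> 0"
    then show ?thesis using forced proper nn by (cases "l < m1 + m2 + m3") auto
  qed
  then show ?thesis
  proof cases
    case forced
    have r: "?rc = l - (m1 + m2 + m3)" "?r1 = l - (m2 + m3)" "?r2 = l - (m1 + m3)" "?r3 = l - m3"
      using forced nn by (auto simp: of_bool_def split: if_splits)
    have "m1 + m2 + m3 \<le> l" using forced by (auto simp: of_bool_def split: if_splits)
    then show ?thesis using D unfolding r by (simp add: algebra_simps)
  next
    case proper
    then have rc: "?rc = 0" by simp
    \<comment> \<open>In this order the bound is the second family of (D), the fourth for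
      \<open>i = 1\<close> and for \<open>i = 2\<close>, the fifth, and nonnegativity.\<close>
    consider "m2 + m3 \<le> l" "m1 + m3 \<le> l" | "m2 + m3 \<le> l" "m1 + m3 > l"
      | "m2 + m3 > l" "m1 + m3 \<le> l" | "m2 + m3 > l" "m1 + m3 > l" "m3 \<le> l" | "m3 > l"
      by linarith
    then show ?thesis
    proof cases
      case 1
      then have r: "?r1 = l - (m2 + m3)" "?r2 = l - (m1 + m3)" "?r3 = l - m3" using proper by auto
      show ?thesis using D unfolding rc r by (simp add: algebra_simps)
    next
      case 2
      then have r: "?r1 = l - (m2 + m3)" "?r2 = 0" "?r3 = l - m3" using proper by auto
      show ?thesis using D 2 unfolding rc r by (simp add: algebra_simps)
    next
      case 3
      then have r: "?r1 = 0" "?r2 = l - (m1 + m3)" "?r3 = l - m3" using proper by auto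
      show ?thesis using D 3 unfolding rc r by (simp add: algebra_simps)
    next
      case 4
      then have r: "?r1 = 0" "?r2 = 0" "?r3 = l - m3" using proper by auto
      show ?thesis using D 4 unfolding rc r by (simp add: algebra_simps)
    next
      case 5
      then have r: "?r1 = 0" "?r2 = 0" "?r3 = 0" using proper by auto
      show ?thesis using zsum_nonneg[of Q] unfolding rc r by simp
    qed
  next
    case contain1
    then have rc: "?rc = 1" "?r1 = 0" by auto
    show ?thesis
    proof (cases "1 \<le> l - m3")
      case True
      then have r: "?r2 = l - m3" "?r3 = l - m3" using contain1 by auto
      show ?thesis using D contain1 unfolding rc r by (simp add: algebra_simps)
    next
      case False
      then have r: "?r2 = 1" "?r3 = 0" using contain1 by auto
      have "zsum (S1 - S2) \<le> zsum Q" using contain1(1) unfolding m1_def by (intro zsum_mono) auto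
      then show ?thesis using zsum_bounds(4) unfolding rc r by (simp add: algebra_simps)
    qed
  next
    case contain2
    then have rc: "?rc = 1" "?r2 = 0" by auto
    show ?thesis
    proof (cases "1 \<le> l - m3")
      case True
      then have r: "?r1 = l - m3" "?r3 = l - m3" using contain2 by auto
      show ?thesis using D contain2 unfolding rc r by (simp add: algebra_simps)
    next
      case False
      then have r: "?r1 = 1" "?r3 = 0" using contain2 by auto
      have "zsum (S2 - S1) \<le> zsum Q" using contain2(2) unfolding m2_def by (intro zsum_mono) auto
      then show ?thesis using zsum_bounds(5) unfolding rc r by (simp add: algebra_simps)
    qed
  next
    case contain12
    then have rc: "?rc = 2" "?r1 = 1" "?r2 = 1" by auto
    have sub: "S1 - S2 \<subseteq> Q" "S2 - S1 \<subseteq> Q" using contain12 unfolding m1_def m2_def by auto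
    have "zsum (Q - (S1 - S2) \<union> (S1 - S2)) = zsum (Q - (S1 - S2)) + zsum (S1 - S2)"
      by (rule zsum_union) auto
    then have z1: "zsum Q = zsum (Q - (S1 - S2)) + zsum (S1 - S2)" using sub by (simp add: Un_absorb2)
    show ?thesis
    proof (cases "1 \<le> l - m3")
      case True
      then have m3: "m3 = l - 1" using contain12 by simp
      then have r: "?r3 = 1" by simp
      have e: "S2 - S1 - (Q - (S1 - S2)) = S2 - S1 - Q" "- (S1 \<union> S2) - (Q - (S1 - S2)) = - (S1 \<union> S2) - Q"
        by auto
      \<comment> \<open>The third family of (D) for \<open>i = 2\<close>, after removal of the first
        block; its coefficient \<open>l - 1 - m3\<close> is zero.\<close>
      have "\<delta> $ 0 - \<delta> $ 2 + \<delta> $ 3 \<le> zsum (Q - (S1 - S2))"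
        using iffD1[OF lower_ineqs_iff lower_ineqs[of "Q - (S1 - S2)"], unfolded e,
            folded m2_def m3_def] contain12(2) m3 by simp
      then show ?thesis using z1 zsum_bounds(4) unfolding rc r by (simp add: algebra_simps)
    next
      case False
      then have r: "?r3 = 0" by simp
      have "zsum (S2 - S1) \<le> zsum (Q - (S1 - S2))" using sub by (intro zsum_mono) auto
      then show ?thesis using z1 zsum_bounds(4,5) unfolding rc r by (simp add: algebra_simps)
    qed
  qed
qed

text \<open>If the cardinality forces more than one block does, the caps on \<open>- Q\<close> are
  subtracted from the total, which is at least \<open>l\<close>. If only the hit of
  \<open>S1 \<inter> S2\<close> counts, this set is removed from \<open>Q\<close> and contributes
  \<open>1 - \<delta> $ 0\<close>.\<close>

lemma zsum_lower:
  fixes Q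
  defines "m0 \<equiv> int (card (S1 \<inter> S2 - Q))" and "m1 \<equiv> int (card (S1 - S2 - Q))"
    and "m2 \<equiv> int (card (S2 - S1 - Q))" and "m3 \<equiv> int (card (- (S1 \<union> S2) - Q))"
  shows "of_int (max (of_bool (m0 = 0)) (l - (m0 + m1 + m2 + m3))) * (1 - \<delta> $ 0)
    + of_int (max (of_bool (m1 = 0) + of_bool (m2 = 0)) (l - (m1 + m2 + m3))) * (\<delta> $ 0 + \<delta> $ 3 - \<delta> $ 1 - \<delta> $ 2)
    + of_int (max (of_bool (m2 = 0)) (l - (m2 + m3))) * (\<delta> $ 1 - \<delta> $ 3)
    + of_int (max (of_bool (m1 = 0)) (l - (m1 + m3))) * (\<delta> $ 2 - \<delta> $ 3)
    + of_int (max 0 (l - m3)) * \<delta> $ 3 \<le> zsum Q"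
    (is "of_int ?r0 * _ + of_int ?rc * _ + of_int ?r1 * _ + of_int ?r2 * _ + of_int ?r3 * _ \<le> _")
proof -
  have nn: "0 \<le> m0" "0 \<le> m1" "0 \<le> m2" "0 \<le> m3" unfolding m0_def m1_def m2_def m3_def by auto
  consider (forced) "of_bool (m0 = 0) < l - (m0 + m1 + m2 + m3)"
    | (contain) "m0 = 0" "?r0 = 1" | (proper) "?r0 = 0"
    using nn by (cases "m0 = 0"; cases "of_bool (m0 = 0) < l - (m0 + m1 + m2 + m3)") auto
  then show ?thesis
  proof cases
    case forced
    have r: "?r0 = l - (m0 + m1 + m2 + m3)" "?rc = l - (m1 + m2 + m3)" "?r1 = l - (m2 + m3)"
      "?r2 = l - (m1 + m3)" "?r3 = l - m3"
      using forced nn by (auto simp: of_bool_def split: if_splits)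
    have e: "- Q \<inter> (S1 \<inter> S2) = S1 \<inter> S2 - Q" "- Q \<inter> (S1 - S2) = S1 - S2 - Q"
      "- Q \<inter> (S2 - S1) = S2 - S1 - Q" "- Q - (S1 \<union> S2) = - (S1 \<union> S2) - Q" by auto
    have "zsum (- Q) \<le> of_int m0 * (1 - \<delta> $ 0) + of_int m1 * (1 - \<delta> $ 1) + of_int m2 * (1 - \<delta> $ 2) + of_int m3"
      using zsum_le_caps[of "- Q", unfolded e] unfolding m0_def m1_def m2_def m3_def by simp
    moreover have "zsum UNIV = zsum Q + zsum (- Q)" using zsum_union[of Q "- Q"] by simp
    ultimately show ?thesis using zsum_bounds(2) unfolding r by (simp add: algebra_simps)
  next
    case proper
    show ?thesis using zsum_lower_core[of Q, folded m1_def m2_def m3_def] unfolding proper by simp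
  next
    case contain
    have e: "S1 - S2 - (Q - S1 \<inter> S2) = S1 - S2 - Q" "S2 - S1 - (Q - S1 \<inter> S2) = S2 - S1 - Q"
      "- (S1 \<union> S2) - (Q - S1 \<inter> S2) = - (S1 \<union> S2) - Q" by auto
    have "S1 \<inter> S2 \<subseteq> Q" using contain(1) unfolding m0_def by auto
    moreover have "zsum (Q - S1 \<inter> S2 \<union> S1 \<inter> S2) = zsum (Q - S1 \<inter> S2) + zsum (S1 \<inter> S2)"
      by (rule zsum_union) auto
    ultimately have "zsum Q = zsum (Q - S1 \<inter> S2) + zsum (S1 \<inter> S2)" by (simp add: Un_absorb2)
    then show ?thesis
      using zsum_lower_core[of "Q - S1 \<inter> S2", unfolded e, folded m1_def m2_def m3_def] zsum_bounds(3)
      unfolding contain(2) by (simp add: algebra_simps)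
  qed
qed

end

section \<open>Convexity of the polyhedron\<close>

lemma convex_Collect_conj: "convex {p. P p} \<Longrightarrow> convex {p. R p} \<Longrightarrow> convex {p. P p \<and> R p}"
  by (simp add: Collect_conj_eq convex_Int)

lemma convex_Collect_all: "(\<And>i. convex {p. P i p}) \<Longrightarrow> convex {p. \<forall>i. P i p}"
  by (simp add: Collect_all_eq convex_INT)

lemma convex_Collect_imp: "(A \<Longrightarrow> convex {p. P p}) \<Longrightarrow> convex {p. A \<longrightarrow> P p}"
  by (cases A) auto

lemma convex_Collect_le:
  fixes f g :: "'a::real_vector \<Rightarrow> real"
  assumes "\<And>p q t. f ((1 - t) *\<^sub>R p + t *\<^sub>R q) = (1 - t) * f p + t * f q"
    and "\<And>p q t. g ((1 - t) *\<^sub>R p + t *\<^sub>R q) = (1 - t) * g p + t * g q"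
  shows "convex {p. f p \<le> g p}"
  unfolding convex_alt using assms by (auto intro!: add_mono mult_left_mono)

text \<open>The side conditions involve only \<open>Q\<close> and not the point, so each inequality
  contributes a half-space or the whole space.\<close>

lemma convex_polyhedron:
  "convex {(\<delta>, z). delta_ineqs \<delta> \<and> basic_ineqs l u S1 S2 \<delta> z \<and>
     (\<forall>Q. upper_ineqs u S1 S2 \<delta> z Q) \<and> (\<forall>Q. lower_ineqs l S1 S2 \<delta> z Q)}"
  unfolding case_prod_beta delta_ineqs_def basic_ineqs_def Let_def Ball_def
    upper_ineqs_iff lower_ineqs_iff
  by (intro convex_Collect_conj convex_Collect_all convex_Collect_imp convex_Collect_le)
     (simp_all add: algebra_simps sum.distrib sum_subtractf flip: sum_distrib_left)

section \<open>Vertices and validity of the inequalities\<close>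

lemma prod_ind_vec:
  "(\<Prod>j\<in>S. 1 - ind_vec X $ j) = (of_bool (X \<inter> S = {}) :: real)" for S :: "'j::finite set"
proof (cases "X \<inter> S = {}")
  case True
  then have "(\<Prod>j\<in>S. 1 - ind_vec X $ j) = (\<Prod>j\<in>S. 1)"
    by (intro prod.cong) (auto simp: ind_vec_def)
  then show ?thesis using True by simp
next
  case False
  then have "\<exists>j\<in>S. 1 - ind_vec X $ j = 0" by (auto simp: ind_vec_def)
  then show ?thesis using False by simp
qed

text \<open>A binary \<open>z\<close> is the indicator of a set \<open>X\<close>, and a product over
  \<open>S\<close> is 1 exactly if \<open>X\<close> misses \<open>S\<close>; this covers the empty
  product.\<close>

lemma Xbar_eq:
  "Xbar l u S1 S2 = (\<lambda>X. ((\<chi> i. of_bool (X \<inter> term_set S1 S2 i = {})), ind_vec X)) `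
     {X. l \<le> int (card X) \<and> int (card X) \<le> u}" (is "_ = ?f ` ?C")
proof (intro equalityI subsetI)
  fix p assume p: "p \<in> Xbar l u S1 S2"
  obtain \<delta> z where [simp]: "p = (\<delta>, z)" by (cases p)
  define X where "X = {j. z $ j = 1}"
  have z: "z = ind_vec X" using p by (auto simp: Xbar_def X_def ind_vec_def vec_eq_iff)
  have "\<delta> = (\<chi> i. of_bool (X \<inter> term_set S1 S2 i = {}))"
    using p by (simp add: Xbar_def vec_eq_iff z prod_ind_vec)
  moreover have "l \<le> int (card X)" "int (card X) \<le> u"
    using p by (simp_all add: Xbar_def z sum_ind_vec)
  ultimately show "p \<in> ?f ` ?C" using z by auto
next
  fix p assume "p \<in> ?f ` ?C"
  then show "p \<in> Xbar l u S1 S2"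
    by (auto simp: Xbar_def prod_ind_vec sum_ind_vec) (auto simp: ind_vec_def)
qed

lemma card_regions:
  fixes X :: "'j::finite set"
  shows "card X = card (X \<inter> (S1 \<inter> S2)) + card (X \<inter> (S1 - S2)) + card (X \<inter> (S2 - S1)) + card (X - (S1 \<union> S2))"
  using sum_Un_regions[of "\<lambda>_. 1" X S1 S2] by (simp flip: of_nat_add)

context
  fixes l u :: int and S1 S2 X :: "'j::finite set" and \<delta> :: "real^4" and t0 t1 t2 t3 :: nat
  assumes X: "l \<le> int (card X)" "int (card X) \<le> u"
  defines "\<delta> \<equiv> (\<chi> i. of_bool (X \<inter> term_set S1 S2 i = {}))"
    and "t0 \<equiv> card (X \<inter> (S1 \<inter> S2))" and "t1 \<equiv> card (X \<inter> (S1 - S2))"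
    and "t2 \<equiv> card (X \<inter> (S2 - S1))" and "t3 \<equiv> card (X - (S1 \<union> S2))"
begin

lemma delta_val: "\<delta> $ 0 = of_bool (t0 = 0)" "\<delta> $ 1 = of_bool (t0 = 0 \<and> t1 = 0)"
  "\<delta> $ 2 = of_bool (t0 = 0 \<and> t2 = 0)" "\<delta> $ 3 = of_bool (t0 = 0 \<and> t1 = 0 \<and> t2 = 0)"
  unfolding \<delta>_def term_set_def t0_def t1_def t2_def by (auto simp: of_bool_def)

lemma card_X: "int t0 + int t1 + int t2 + int t3 = int (card X)"
  using card_regions[of X S1 S2] unfolding t0_def t1_def t2_def t3_def by simp

lemma delta_ineqs_vertex: "delta_ineqs \<delta>"
  unfolding delta_ineqs_def by (auto simp: delta_val of_bool_def)

lemma basic_ineqs_vertex: "basic_ineqs l u S1 S2 \<delta> (ind_vec X)"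
proof -
  have e: "S1 - S1 \<inter> S2 = S1 - S2" "S2 - S1 \<inter> S2 = S2 - S1" by auto
  have c: "ind_vec X $ j + \<delta> $ i \<le> 1" if "j \<in> term_set S1 S2 i" for i j
    using that unfolding \<delta>_def ind_vec_def by auto
  have t: "1 \<le> real n" if "n \<noteq> 0" for n using that by simp
  have b: "ind_vec X $ j \<le> 1" "0 \<le> ind_vec X $ j" for j by (simp_all add: ind_vec_def)
  have s: "1 - \<delta> $ 0 \<le> real t0" "\<delta> $ 0 - \<delta> $ 1 \<le> real t1" "\<delta> $ 0 - \<delta> $ 2 \<le> real t2"
    unfolding delta_val using t by (auto simp: of_bool_def)
  have T: "term_set S1 S2 0 = S1 \<inter> S2" "term_set S1 S2 1 = S1" "term_set S1 S2 2 = S2"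
    by (simp_all add: term_set_def)
  show ?thesis
    using X s b c unfolding basic_ineqs_def Let_def
    by (auto simp: T e sum_ind_vec t0_def t1_def t2_def simp del: One_nat_def)
qed

text \<open>Once it is known which of \<open>t0\<close>, \<open>t1\<close>, \<open>t2\<close>
  vanish, \<open>\<delta>\<close> is constant and everything is linear. A nonzero count is at least
  1, which pays for the unit lost in the third family.\<close>

lemma upper_ineqs_vertex: "upper_ineqs u S1 S2 \<delta> (ind_vec X) Q"
proof -
  define q1 where "q1 = int (card (Q \<inter> (S1 - S2)))"
  define q2 where "q2 = int (card (Q \<inter> (S2 - S1)))"
  define q3 where "q3 = int (card (Q - (S1 \<union> S2)))"
  define x where "x R = int (card (X \<inter> Q \<inter> R))" for R
  let ?x0 = "x (S1 \<inter> S2)" and ?x1 = "x (S1 - S2)" and ?x2 = "x (S2 - S1)"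
    and ?x3 = "x (- (S1 \<union> S2))"
  have s: "(\<Sum>j\<in>Q. ind_vec X $ j) = of_int (?x0 + ?x1 + ?x2 + ?x3)"
    using card_regions[of "X \<inter> Q" S1 S2] unfolding sum_ind_vec x_def by (simp add: Diff_eq)
  have le: "0 \<le> ?x0" "0 \<le> ?x1" "0 \<le> ?x2" "0 \<le> ?x3" "?x0 \<le> int t0" "?x1 \<le> int t1" "?x2 \<le> int t2" "?x3 \<le> int t3"
    "?x1 \<le> q1" "?x2 \<le> q2" "?x3 \<le> q3"
    unfolding x_def t0_def t1_def t2_def t3_def q1_def q2_def q3_def
    by (auto intro!: card_mono)
  have u: "int t0 + int t1 + int t2 + int t3 \<le> u" using card_X X by simp
  note r = iffD2[OF of_int_le_iff[where 'a=real]]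
  note rl = le[THEN r] u[THEN r]
  have i: "t0 \<noteq> 0 \<Longrightarrow> 1 \<le> real t0" "t1 \<noteq> 0 \<Longrightarrow> 1 \<le> real t1" "t2 \<noteq> 0 \<Longrightarrow> 1 \<le> real t2"
    by simp_all
  show ?thesis
    unfolding upper_ineqs_iff[where Q = Q] q1_def[symmetric] q2_def[symmetric] q3_def[symmetric] s delta_val
    using rl i by (cases "t0 = 0"; cases "t1 = 0"; cases "t2 = 0") auto
qed

text \<open>As for the upper inequalities, but \<open>X\<close> is also counted outside
  \<open>Q\<close>: there it has at most as many elements as \<open>Q\<close> misses, and the rest
  of the required \<open>l\<close> lies in \<open>Q\<close>.\<close>

lemma lower_ineqs_vertex: "lower_ineqs l S1 S2 \<delta> (ind_vec X) Q"
proof -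
  define m1 where "m1 = int (card (S1 - S2 - Q))"
  define m2 where "m2 = int (card (S2 - S1 - Q))"
  define m3 where "m3 = int (card (- (S1 \<union> S2) - Q))"
  define x where "x R = int (card (X \<inter> Q \<inter> R))" for R
  define y where "y R = int (card (X \<inter> R - Q))" for R
  let ?x0 = "x (S1 \<inter> S2)" and ?x1 = "x (S1 - S2)" and ?x2 = "x (S2 - S1)"
    and ?x3 = "x (- (S1 \<union> S2))"
  let ?y0 = "y (S1 \<inter> S2)" and ?y1 = "y (S1 - S2)" and ?y2 = "y (S2 - S1)"
    and ?y3 = "y (- (S1 \<union> S2))"
  have s: "(\<Sum>j\<in>Q. ind_vec X $ j) = of_int (?x0 + ?x1 + ?x2 + ?x3)"
    using card_regions[of "X \<inter> Q" S1 S2] unfolding sum_ind_vec x_def by (simp add: Diff_eq)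
  have xy: "x R + y R = int (card (X \<inter> R))" for R
    unfolding x_def y_def of_nat_add[symmetric] of_nat_eq_iff by (rule card_union2[symmetric]) auto
  have t: "int t0 = ?x0 + ?y0" "int t1 = ?x1 + ?y1" "int t2 = ?x2 + ?y2" "int t3 = ?x3 + ?y3"
    unfolding xy t0_def t1_def t2_def t3_def by (simp_all add: Diff_eq)
  have le: "0 \<le> ?x0" "0 \<le> ?x1" "0 \<le> ?x2" "0 \<le> ?x3" "0 \<le> ?y0" "0 \<le> ?y1" "0 \<le> ?y2" "0 \<le> ?y3"
    "?y1 \<le> m1" "?y2 \<le> m2" "?y3 \<le> m3"
    unfolding x_def y_def m1_def m2_def m3_def by (auto intro!: card_mono)
  have l: "l \<le> int t0 + int t1 + int t2 + int t3" using card_X X by simp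
  note r = iffD2[OF of_int_le_iff[where 'a=real]]
  note rl = le[THEN r] l[THEN r]
  have rt: "real t0 = of_int ?x0 + of_int ?y0" "real t1 = of_int ?x1 + of_int ?y1"
    "real t2 = of_int ?x2 + of_int ?y2" "real t3 = of_int ?x3 + of_int ?y3"
    using t by linarith+
  have i: "t0 \<noteq> 0 \<Longrightarrow> 1 \<le> real t0" "t1 \<noteq> 0 \<Longrightarrow> 1 \<le> real t1" "t2 \<noteq> 0 \<Longrightarrow> 1 \<le> real t2"
    by simp_all
  show ?thesis
    unfolding lower_ineqs_iff[where Q = Q] m1_def[symmetric] m2_def[symmetric] m3_def[symmetric] s delta_val
    using rl rt i by (cases "t0 = 0"; cases "t1 = 0"; cases "t2 = 0") auto
qed

end

section \<open>The five patterns of \<open>\<delta>\<close> and their hitting sets\<close>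

datatype pattern = Pat_none | Pat_0 | Pat_01 | Pat_02 | Pat_all

lemma UNIV_pattern: "(UNIV :: pattern set) = {Pat_none, Pat_0, Pat_01, Pat_02, Pat_all}"
  by (auto intro: pattern.exhaust)

text \<open>The digits in a constructor name are the indices \<open>i\<close> with
  \<open>\<delta> $ i = 1\<close>.\<close>

fun pattern_vec :: "pattern \<Rightarrow> real^4" where
  "pattern_vec Pat_none = 0"
| "pattern_vec Pat_0 = (\<chi> i. of_bool (i = 0))"
| "pattern_vec Pat_01 = (\<chi> i. of_bool (i \<in> {0, 1}))"
| "pattern_vec Pat_02 = (\<chi> i. of_bool (i \<in> {0, 2}))"
| "pattern_vec Pat_all = 1"

text \<open>Barycentric coordinates of \<open>\<delta>\<close> in the simplex spanned by the pattern
  vectors; (A) says exactly that they are nonnegative.\<close>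

fun pattern_weight :: "real^4 \<Rightarrow> pattern \<Rightarrow> real" where
  "pattern_weight \<delta> Pat_none = 1 - \<delta> $ 0"
| "pattern_weight \<delta> Pat_0 = \<delta> $ 0 + \<delta> $ 3 - \<delta> $ 1 - \<delta> $ 2"
| "pattern_weight \<delta> Pat_01 = \<delta> $ 1 - \<delta> $ 3"
| "pattern_weight \<delta> Pat_02 = \<delta> $ 2 - \<delta> $ 3"
| "pattern_weight \<delta> Pat_all = \<delta> $ 3"

fun pattern_support :: "'j set \<Rightarrow> 'j set \<Rightarrow> pattern \<Rightarrow> 'j set" where
  "pattern_support S1 S2 Pat_none = UNIV"
| "pattern_support S1 S2 Pat_0 = - (S1 \<inter> S2)"
| "pattern_support S1 S2 Pat_01 = - S1"
| "pattern_support S1 S2 Pat_02 = - S2"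
| "pattern_support S1 S2 Pat_all = - (S1 \<union> S2)"

text \<open>Only the part of a set inside the support can be hit, which makes the blocks disjoint.
  Hitting \<open>S1 \<inter> S2\<close> hits all four sets; if it is empty, the pattern has no
  hitting set.\<close>

fun pattern_blocks :: "'j set \<Rightarrow> 'j set \<Rightarrow> pattern \<Rightarrow> 'j set set" where
  "pattern_blocks S1 S2 Pat_none = {S1 \<inter> S2}"
| "pattern_blocks S1 S2 Pat_0 = {S1 - S2, S2 - S1}"
| "pattern_blocks S1 S2 Pat_01 = {S2 - S1}"
| "pattern_blocks S1 S2 Pat_02 = {S1 - S2}"
| "pattern_blocks S1 S2 Pat_all = {}"

lemma card_filter_singleton: "card {B \<in> {R}. P B} = of_bool (P R)"
  by (auto simp: Collect_conv_if)

lemma card_filter_doubleton: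
  assumes "R \<noteq> R'"
  shows "card {B \<in> {R, R'}. P B} = of_bool (P R) + of_bool (P R')"
proof -
  have "{B \<in> {R, R'}. P B} = {B \<in> {R}. P B} \<union> {B \<in> {R'}. P B}" by blast
  then have "card {B \<in> {R, R'}. P B} = card {B \<in> {R}. P B} + card {B \<in> {R'}. P B}"
    using assms by (simp only:) (rule card_Un_disjoint, auto)
  then show ?thesis by (simp only: card_filter_singleton)
qed

text \<open>These are the coefficients in \<open>zsum_upper\<close>.\<close>

lemma pattern_upper_rank:
  fixes u :: int and Q S1 S2 :: "'j::finite set"
  assumes "S1 - S2 \<noteq> {}"
  defines "q0 \<equiv> int (card (Q \<inter> (S1 \<inter> S2)))" and "q1 \<equiv> int (card (Q \<inter> (S1 - S2)))"
    and "q2 \<equiv> int (card (Q \<inter> (S2 - S1)))" and "q3 \<equiv> int (card (Q - (S1 \<union> S2)))"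
  defines "r \<equiv> \<lambda>k. upper_rank u (pattern_support S1 S2 k) (pattern_blocks S1 S2 k) Q"
  shows "r Pat_none = min (q0 + q1 + q2 + q3) (u - of_bool (q0 = 0))"
    and "r Pat_0 = min (q1 + q2 + q3) (u - (of_bool (q1 = 0) + of_bool (q2 = 0)))"
    and "r Pat_01 = min (q2 + q3) (u - of_bool (q2 = 0))"
    and "r Pat_02 = min (q1 + q3) (u - of_bool (q1 = 0))"
    and "r Pat_all = min q3 u"
proof -
  \<comment> \<open>The two blocks must differ to be counted twice in the family.\<close>
  have ne: "S1 - S2 \<noteq> S2 - S1" using assms(1) by blast
  have c: "int (card Q) = q0 + q1 + q2 + q3"
    unfolding q0_def q1_def q2_def q3_def using card_regions[of Q S1 S2] by simp
  have c0: "int (card (Q \<inter> - (S1 \<inter> S2))) = q1 + q2 + q3"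
    unfolding q1_def q2_def q3_def of_nat_add[symmetric] of_nat_eq_iff by (rule card_union3) auto
  have c1: "int (card (Q \<inter> - S1)) = q2 + q3"
    unfolding q2_def q3_def of_nat_add[symmetric] of_nat_eq_iff by (rule card_union2) auto
  have c2: "int (card (Q \<inter> - S2)) = q1 + q3"
    unfolding q1_def q3_def of_nat_add[symmetric] of_nat_eq_iff by (rule card_union2) auto
  have c3: "int (card (Q \<inter> - (S1 \<union> S2))) = q3" unfolding q3_def by (simp add: Diff_eq)
  have z: "S1 \<inter> S2 \<inter> Q = {} \<longleftrightarrow> q0 = 0" "(S1 - S2) \<inter> Q = {} \<longleftrightarrow> q1 = 0" "(S2 - S1) \<inter> Q = {} \<longleftrightarrow> q2 = 0"
    unfolding q0_def q1_def q2_def by auto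
  show "r Pat_none = min (q0 + q1 + q2 + q3) (u - of_bool (q0 = 0))"
    unfolding r_def upper_rank_def pattern_support.simps pattern_blocks.simps card_filter_singleton z
    by (simp add: c)
  show "r Pat_0 = min (q1 + q2 + q3) (u - (of_bool (q1 = 0) + of_bool (q2 = 0)))"
    unfolding r_def upper_rank_def pattern_support.simps pattern_blocks.simps
      card_filter_doubleton[OF ne] z c0 by simp
  show "r Pat_01 = min (q2 + q3) (u - of_bool (q2 = 0))"
    unfolding r_def upper_rank_def pattern_support.simps pattern_blocks.simps card_filter_singleton z c1
    by simp
  show "r Pat_02 = min (q1 + q3) (u - of_bool (q1 = 0))"
    unfolding r_def upper_rank_def pattern_support.simps pattern_blocks.simps card_filter_singleton z c2
    by simp
  show "r Pat_all = min q3 u"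
    unfolding r_def upper_rank_def pattern_support.simps pattern_blocks.simps c3 by simp
qed

lemma pattern_lower_rank:
  fixes l :: int and Q S1 S2 :: "'j::finite set"
  assumes "S1 - S2 \<noteq> {}"
  defines "m0 \<equiv> int (card (S1 \<inter> S2 - Q))" and "m1 \<equiv> int (card (S1 - S2 - Q))"
    and "m2 \<equiv> int (card (S2 - S1 - Q))" and "m3 \<equiv> int (card (- (S1 \<union> S2) - Q))"
  defines "r \<equiv> \<lambda>k. lower_rank l (pattern_support S1 S2 k) (pattern_blocks S1 S2 k) Q"
  shows "r Pat_none = max (of_bool (m0 = 0)) (l - (m0 + m1 + m2 + m3))"
    and "r Pat_0 = max (of_bool (m1 = 0) + of_bool (m2 = 0)) (l - (m1 + m2 + m3))"
    and "r Pat_01 = max (of_bool (m2 = 0)) (l - (m2 + m3))"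
    and "r Pat_02 = max (of_bool (m1 = 0)) (l - (m1 + m3))"
    and "r Pat_all = max 0 (l - m3)"
proof -
  have ne: "S1 - S2 \<noteq> S2 - S1" using assms(1) by blast
  have "card (UNIV - Q) = card (S1 \<inter> S2 - Q) + card (- (S1 \<inter> S2) - Q)"
    by (rule card_union2) auto
  moreover have c0: "int (card (- (S1 \<inter> S2) - Q)) = m1 + m2 + m3"
    unfolding m1_def m2_def m3_def of_nat_add[symmetric] of_nat_eq_iff by (rule card_union3) auto
  ultimately have c: "int (card (UNIV - Q)) = m0 + m1 + m2 + m3" unfolding m0_def by simp
  have c1: "int (card (- S1 - Q)) = m2 + m3"
    unfolding m2_def m3_def of_nat_add[symmetric] of_nat_eq_iff by (rule card_union2) auto
  have c2: "int (card (- S2 - Q)) = m1 + m3"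
    unfolding m1_def m3_def of_nat_add[symmetric] of_nat_eq_iff by (rule card_union2) auto
  have z: "S1 \<inter> S2 \<subseteq> Q \<longleftrightarrow> m0 = 0" "S1 - S2 \<subseteq> Q \<longleftrightarrow> m1 = 0" "S2 - S1 \<subseteq> Q \<longleftrightarrow> m2 = 0"
    unfolding m0_def m1_def m2_def by auto
  show "r Pat_none = max (of_bool (m0 = 0)) (l - (m0 + m1 + m2 + m3))"
    unfolding r_def lower_rank_def pattern_support.simps pattern_blocks.simps card_filter_singleton z c
    by simp
  show "r Pat_0 = max (of_bool (m1 = 0) + of_bool (m2 = 0)) (l - (m1 + m2 + m3))"
    unfolding r_def lower_rank_def pattern_support.simps pattern_blocks.simps
      card_filter_doubleton[OF ne] z c0 by simp
  show "r Pat_01 = max (of_bool (m2 = 0)) (l - (m2 + m3))"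
    unfolding r_def lower_rank_def pattern_support.simps pattern_blocks.simps card_filter_singleton z c1
    by simp
  show "r Pat_02 = max (of_bool (m1 = 0)) (l - (m1 + m3))"
    unfolding r_def lower_rank_def pattern_support.simps pattern_blocks.simps card_filter_singleton z c2
    by simp
  show "r Pat_all = max 0 (l - m3)"
    unfolding r_def lower_rank_def pattern_support.simps pattern_blocks.simps m3_def by simp
qed

lemma sum_pattern:
  "sum f UNIV = f Pat_none + f Pat_0 + f Pat_01 + f Pat_02 + f Pat_all"
  unfolding UNIV_pattern by (simp add: add.assoc)

lemma pattern_mixture: "(\<Sum>k\<in>UNIV. pattern_weight \<delta> k *\<^sub>R pattern_vec k) = \<delta>"
proof -
  \<comment> \<open>\<open>forall_4\<close> runs through the indices 1 to 4, and the last of them is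
    the coordinate 0.\<close>
  have "(4::4) = 0" by simp
  then show ?thesis by (simp only: sum_pattern vec_eq_iff forall_4) simp
qed

lemma pattern_vertex_in_Xbar:
  assumes "X \<in> hitting_sets l u (pattern_support S1 S2 k) (pattern_blocks S1 S2 k)"
  shows "(pattern_vec k, ind_vec X) \<in> Xbar l u S1 S2"
proof -
  have "pattern_vec k = (\<chi> i. of_bool (X \<inter> term_set S1 S2 i = {}))"
  proof (cases k)
    case Pat_none
    then have "X \<inter> (S1 \<inter> S2) \<noteq> {}" using assms by (simp add: hitting_sets_def)
    then have "X \<inter> term_set S1 S2 i \<noteq> {}" for i unfolding term_set_def by auto
    then show ?thesis using Pat_none by (simp add: vec_eq_iff)
  next
    case Pat_0
    then have "X \<inter> (S1 \<inter> S2) = {}" "X \<inter> (S1 - S2) \<noteq> {}" "X \<inter> (S2 - S1) \<noteq> {}"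
      using assms by (auto simp: hitting_sets_def)
    then have "X \<inter> term_set S1 S2 i = {} \<longleftrightarrow> i = 0" for i unfolding term_set_def by auto
    then show ?thesis using Pat_0 by simp
  next
    case Pat_01
    then have "X \<inter> S1 = {}" "X \<inter> (S2 - S1) \<noteq> {}"
      using assms by (auto simp: hitting_sets_def)
    then have "X \<inter> term_set S1 S2 i = {} \<longleftrightarrow> i \<in> {0, 1}" for i unfolding term_set_def by auto
    then show ?thesis using Pat_01 by simp
  next
    case Pat_02
    then have "X \<inter> S2 = {}" "X \<inter> (S1 - S2) \<noteq> {}"
      using assms by (auto simp: hitting_sets_def)
    then have "X \<inter> term_set S1 S2 i = {} \<longleftrightarrow> i \<in> {0, 2}" for i unfolding term_set_def by auto
    then show ?thesis using Pat_02 by simp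
  next
    case Pat_all
    then have "X \<inter> (S1 \<union> S2) = {}" using assms by (auto simp: hitting_sets_def)
    then have "X \<inter> term_set S1 S2 i = {}" for i unfolding term_set_def by auto
    then show ?thesis using Pat_all by (simp add: vec_eq_iff)
  qed
  moreover have "l \<le> int (card X)" "int (card X) \<le> u" using assms by (auto simp: hitting_sets_def)
  ultimately show ?thesis unfolding Xbar_eq by auto
qed

section \<open>Every point of the polyhedron is a convex combination of vertices\<close>

context polyhedron_point
begin

text \<open>The size bounds on \<open>S1\<close> and \<open>S2\<close> leave enough room in the
  supports, except for \<open>Pat_all\<close>. This pattern, and \<open>Pat_none\<close> if the sets
  are disjoint, can be infeasible, but then the inequalities make its weight zero.\<close>

lemma pattern_hitting_sets_nonempty:
  assumes "pattern_weight \<delta> k > 0" "l \<le> u"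
    and "int (card S1) \<le> int CARD('j) - l" "int (card S2) \<le> int CARD('j) - l"
  shows "hitting_sets l u (pattern_support S1 S2 k) (pattern_blocks S1 S2 k) \<noteq> {}"
proof (rule hitting_sets_nonempty)
  have "card (pattern_blocks S1 S2 k) \<le> 2" by (cases k) (auto simp: card_insert_if)
  then show "int (card (pattern_blocks S1 S2 k)) \<le> u" using u2 by simp
  show "l \<le> u" by fact
  have c: "int (card (- A)) = int CARD('j) - int (card A)" for A :: "'j set"
    by (rule card_complement_eq) simp
  show "l \<le> int (card (pattern_support S1 S2 k))"
  proof (cases k)
    case Pat_none
    then show ?thesis using assms(3) by simp
  next
    case Pat_0
    have "card (S1 \<inter> S2) \<le> card S1" by (intro card_mono) auto
    then show ?thesis using assms(3) Pat_0 by (simp only: pattern_support.simps c)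
  next
    case Pat_01
    then show ?thesis using assms(3) by (simp only: pattern_support.simps c)
  next
    case Pat_02
    then show ?thesis using assms(4) by (simp only: pattern_support.simps c)
  next
    case Pat_all
    show ?thesis
    proof (rule ccontr)
      assume "\<not> ?thesis"
      then have lt: "int (card (- (S1 \<union> S2))) < l" using Pat_all by (simp only: pattern_support.simps)
      \<comment> \<open>The fifth family of (D) with \<open>Q = {}\<close> excludes a positive
        \<open>\<delta> $ 3\<close>.\<close>
      then have "of_int (l - int (card (- (S1 \<union> S2)))) * \<delta> $ 3 \<le> 0"
        using iffD1[OF lower_ineqs_iff lower_ineqs[of "{}"]] by (simp only: Diff_empty sum.empty)
      moreover have "0 < real_of_int (l - int (card (- (S1 \<union> S2)))) * \<delta> $ 3"
        using lt assms(1) Pat_all by (intro mult_pos_pos) auto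
      ultimately show False by linarith
    qed
  qed
  show "B \<subseteq> pattern_support S1 S2 k \<and> B \<noteq> {}" if B: "B \<in> pattern_blocks S1 S2 k" for B
  proof (cases k)
    case Pat_none
    have "S1 \<inter> S2 \<noteq> {}"
    proof
      assume "S1 \<inter> S2 = {}"
      then show False using zsum_bounds(3) assms(1) Pat_none by simp
    qed
    then show ?thesis using B Pat_none by simp
  qed (use B ne1 ne2 in auto)
qed

lemma in_convex_hull_Xbar:
  assumes "l \<le> u" "int (card S1) \<le> int CARD('j) - l" "int (card S2) \<le> int CARD('j) - l"
  shows "(\<delta>, z) \<in> convex hull Xbar l u S1 S2"
proof -
  have "((\<Sum>k\<in>UNIV. pattern_weight \<delta> k *\<^sub>R pattern_vec k), z) \<in> convex hull
    (\<Union>k\<in>UNIV. (\<lambda>X. (pattern_vec k, ind_vec X)) `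
      hitting_sets l u (pattern_support S1 S2 k) (pattern_blocks S1 S2 k))"
  proof (rule mixture_in_convex_hull)
    show "finite (UNIV :: pattern set)" by (simp add: UNIV_pattern)
    show "0 \<le> pattern_weight \<delta> k" for k using delta by (cases k) auto
    show "sum (pattern_weight \<delta>) UNIV = 1" by (simp add: sum_pattern)
    show "hitting_sets l u (pattern_support S1 S2 k) (pattern_blocks S1 S2 k) \<noteq> {}"
      if "pattern_weight \<delta> k > 0" for k
      using pattern_hitting_sets_nonempty[OF that assms] .
    show "disjoint (pattern_blocks S1 S2 k)" for k
      by (cases k) (auto simp: disjoint_def)
    show "B \<subseteq> pattern_support S1 S2 k" if "B \<in> pattern_blocks S1 S2 k" for k B
      using that by (cases k) auto
    show "(\<Sum>j\<in>Q. z $ j) \<le> (\<Sum>k\<in>UNIV. pattern_weight \<delta> k *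
        of_int (upper_rank u (pattern_support S1 S2 k) (pattern_blocks S1 S2 k) Q))" for Q
      using zsum_upper[of Q] unfolding sum_pattern pattern_weight.simps pattern_upper_rank[OF ne1]
      by (simp only: mult.commute)
    show "(\<Sum>k\<in>UNIV. pattern_weight \<delta> k *
        of_int (lower_rank l (pattern_support S1 S2 k) (pattern_blocks S1 S2 k) Q)) \<le> (\<Sum>j\<in>Q. z $ j)" for Q
      using zsum_lower[of Q] unfolding sum_pattern pattern_weight.simps pattern_lower_rank[OF ne1]
      by (simp only: mult.commute)
  qed
  moreover have "(\<Union>k\<in>UNIV. (\<lambda>X. (pattern_vec k, ind_vec X)) `
      hitting_sets l u (pattern_support S1 S2 k) (pattern_blocks S1 S2 k)) \<subseteq> Xbar l u S1 S2"
    using pattern_vertex_in_Xbar by blast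
  ultimately show ?thesis unfolding pattern_mixture using hull_mono by blast
qed

end

theorem theorem13:
  fixes l u :: int and S1 S2 :: "'j::finite set"
  assumes "l \<ge> 0" and "u \<ge> 2" and "u \<ge> l + 1"
    and "2 \<le> card S1" and "int (card S1) \<le> int CARD('j) - l"
    and "2 \<le> card S2" and "int (card S2) \<le> int CARD('j) - l"
    and "S1 - S2 \<noteq> {}" and "S2 - S1 \<noteq> {}"
  shows "convex hull (Xbar l u S1 S2) =
    {(\<delta>, z). delta_ineqs \<delta> \<and> basic_ineqs l u S1 S2 \<delta> z \<and>
       (\<forall>Q. upper_ineqs u S1 S2 \<delta> z Q) \<and> (\<forall>Q. lower_ineqs l S1 S2 \<delta> z Q)}"
    (is "_ = ?P")
proof
  have "Xbar l u S1 S2 \<subseteq> ?P"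
    unfolding Xbar_eq
    using delta_ineqs_vertex basic_ineqs_vertex upper_ineqs_vertex lower_ineqs_vertex by fast
  then show "convex hull (Xbar l u S1 S2) \<subseteq> ?P"
    by (intro hull_minimal convex_polyhedron)
  show "?P \<subseteq> convex hull (Xbar l u S1 S2)"
  proof clarify
    fix \<delta> z
    assume "delta_ineqs \<delta>" "basic_ineqs l u S1 S2 \<delta> z"
      "\<forall>Q. upper_ineqs u S1 S2 \<delta> z Q" "\<forall>Q. lower_ineqs l S1 S2 \<delta> z Q"
    then interpret polyhedron_point l u S1 S2 \<delta> z
      using assms by unfold_locales auto
    show "(\<delta>, z) \<in> convex hull (Xbar l u S1 S2)"
      using assms by (intro in_convex_hull_Xbar) auto
  qed
qed

end
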